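(* Let $(T,\mathcal T,\lambda)$ be a complete atomless probability space, $\mathcal F$ a countably generated sub-$\sigma$-algebra of $\mathcal T$, and $X$ a separable Banach space. If $\mathcal T$ is nowhere equivalent to $\mathcal F$, then the following hold. (B1) For any $\mathcal F$-measurable and weakly compact valued correspondence $F$ from $T$ to $X$, $I_F^{\mathcal T}$ is convex. (B2) For any $\mathcal F$-measurable, integrably bounded and weakly compact valued correspondence $F$ from $T$ to $X$, $I_F^{\mathcal T}$ is weakly compact. (B3) For any $\mathcal F$-measurable, integrably bounded and weakly compact valued correspondence $F$ from $T$ to $X$, $I_F^{\mathcal T}=I_{\overline{co}F}^{\mathcal T}$, where $\overline{co}F(t)$ is the norm closure of the convex hull of $F(t)$ for each $t\in T$. (B4) Let $G$ be an $\mathcal F$-measurable, integrably bounded and weakly compact valued correspondence from $T$ to $X$, let $Y$ be a metric space, and let $F$ be a weakly closed valued correspondence from $T\times Y$ to $X$. If (a) for every $y\in Y$, $F(t,y)\subseteq G(t)$ for $\lambda$-almost all $t\in T$; (b) for every $y\in Y$, $F(\cdot,y)$ is $\mathcal F$-measurable; (c) for every $t\in T$, $F(t,\cdot)$ is weakly upper hemicontinuous; then $H(y)=I_{F_y}^{\mathcal T}$, with $F_y=F(\cdot,y)$, is weakly upper hemicontinuous from $Y$ to $X$.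
   Context: Nowhere equivalence: $\mathcal T$ is nowhere equivalent to $\mathcal F$ if for every $D\in\mathcal T$ with $\lambda(D)>0$ there is a $\mathcal T$-measurable set $D_0\subseteq D$ such that $\lambda(D_0\triangle D_1)>0$ for every $D_1\in\mathcal F^D:=\{D\cap D':D'\in\mathcal F\}$. Correspondences: a correspondence from $T$ to a set $Z$ assigns to each $t\in T$ a nonempty subset of $Z$. If $Z$ is a topological space, $F$ is $\mathcal F$-measurable if $\{t\in T: F(t)\cap E\ne\emptyset\}\in\mathcal F$ for each closed $E\subseteq Z$; here $X$ carries its norm topology for this purpose. $F$ is closed (compact, ...) valued if $F(t)$ has this property for $\lambda$-almost all $t$. A selection of $F$ is a mapping $f$ with $f(t)\in F(t)$ for $\lambda$-almost all $t$. $F$ is integrably bounded if there is an integrable real function $h$ with $\sup\{\|x\|:x\in F(t)\}\le h(t)$ for $\lambda$-almost all $t$. A correspondence $F$ from a topological space $Y$ to a topological space $Z$ is upper hemicontinuous if for each $y_0\in Y$ and each open $O_Z\supseteq F(y_0)$ there is an open neighborhood $O_Y$ of $y_0$ with $F(y)\subseteq O_Z$ for all $y\in O_Y$; "weakly" means that the target carries its weak topology. $I_F^{\mathcal T}=\{\int_T f\,d\lambda: f$ is a $\mathcal T$-measurable Bochner integrable selection of $F\}$ (Bochner integral). *)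

theory Defs
  imports "HOL-Probability.Probability"
begin

definition weak_topology :: "'x::real_normed_vector topology" where
  "weak_topology =
     topology_generated_by {\<phi> -` U |(\<phi> :: 'x \<Rightarrow> real) U. bounded_linear \<phi> \<and> open U}"

lemma topspace_weak_topology [simp]: "topspace weak_topology = UNIV"
proof -
  have "UNIV \<in> {\<phi> -` U |(\<phi> :: 'a \<Rightarrow> real) U. bounded_linear \<phi> \<and> open U}"
    using bounded_linear_zero by (intro CollectI exI[of _ "\<lambda>_. 0"] exI[of _ UNIV]) auto
  then show ?thesis
    unfolding weak_topology_def topology_generated_by_topspace by blast
qed

definition atomless :: "'t measure \<Rightarrow> bool" where
  "atomless M \<longleftrightarrow>
     (\<forall>A\<in>sets M. 0 < measure M A \<longrightarrow>
        (\<exists>B\<in>sets M. B \<subseteq> A \<and> 0 < measure M B \<and> measure M B < measure M A))"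

definition countably_generated :: "'t set \<Rightarrow> 't set set \<Rightarrow> bool" where
  "countably_generated \<Omega> \<F> \<longleftrightarrow> (\<exists>C. countable C \<and> C \<subseteq> Pow \<Omega> \<and> \<F> = sigma_sets \<Omega> C)"

definition nowhere_equivalent :: "'t measure \<Rightarrow> 't set set \<Rightarrow> bool" where
  "nowhere_equivalent M \<F> \<longleftrightarrow>
     (\<forall>D\<in>sets M. 0 < measure M D \<longrightarrow>
        (\<exists>D\<^sub>0\<in>sets M. D\<^sub>0 \<subseteq> D \<and>
           (\<forall>D\<^sub>1\<in>{D \<inter> D' |D'. D' \<in> \<F>}. 0 < measure M (sym_diff D\<^sub>0 D\<^sub>1))))"

definition correspondence :: "'s set \<Rightarrow> 'z set \<Rightarrow> ('s \<Rightarrow> 'z set) \<Rightarrow> bool" where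
  "correspondence S Z F \<longleftrightarrow> (\<forall>s\<in>S. F s \<noteq> {} \<and> F s \<subseteq> Z)"

definition measurable_correspondence ::
  "'t set \<Rightarrow> 't set set \<Rightarrow> ('t \<Rightarrow> 'z::topological_space set) \<Rightarrow> bool" where
  "measurable_correspondence \<Omega> \<F> F \<longleftrightarrow> (\<forall>E. closed E \<longrightarrow> {t\<in>\<Omega>. F t \<inter> E \<noteq> {}} \<in> \<F>)"

definition weakly_compact_valued ::
  "'t measure \<Rightarrow> ('t \<Rightarrow> 'x::real_normed_vector set) \<Rightarrow> bool" where
  "weakly_compact_valued M F \<longleftrightarrow> (AE t in M. compactin weak_topology (F t))"

definition weakly_closed_valued ::
  "'t measure \<Rightarrow> ('t \<Rightarrow> 'x::real_normed_vector set) \<Rightarrow> bool" where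
  "weakly_closed_valued M F \<longleftrightarrow> (AE t in M. closedin weak_topology (F t))"

text \<open>The bound on the supremum of the norms is written pointwise, because the supremum of an
  unbounded set of reals is unspecified.\<close>

definition integrably_bounded ::
  "'t measure \<Rightarrow> ('t \<Rightarrow> 'x::real_normed_vector set) \<Rightarrow> bool" where
  "integrably_bounded M F \<longleftrightarrow>
     (\<exists>h :: 't \<Rightarrow> real. integrable M h \<and> (AE t in M. \<forall>x\<in>F t. norm x \<le> h t))"

definition selection :: "'t measure \<Rightarrow> ('t \<Rightarrow> 'x set) \<Rightarrow> ('t \<Rightarrow> 'x) \<Rightarrow> bool" where
  "selection M F f \<longleftrightarrow> (AE t in M. f t \<in> F t)"

text \<open>Bochner integrability includes Borel measurability with respect to the \<open>\<sigma>\<close>-algebra of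
  the measure; as the target is separable, this is strong measurability.\<close>

definition integral_correspondence ::
  "'t measure \<Rightarrow> ('t \<Rightarrow> 'x::{banach, second_countable_topology} set) \<Rightarrow> 'x set" where
  "integral_correspondence M F =
     {integral\<^sup>L M f |f. integrable M f \<and> selection M F f}"

text \<open>As upper hemicontinuity is a property of correspondences, it includes that all values are
  nonempty.\<close>

definition upper_hemicontinuous ::
  "'y topology \<Rightarrow> 'z topology \<Rightarrow> ('y \<Rightarrow> 'z set) \<Rightarrow> bool" where
  "upper_hemicontinuous Y Z F \<longleftrightarrow>
     correspondence (topspace Y) (topspace Z) F \<and>
     (\<forall>y\<^sub>0\<in>topspace Y. \<forall>V. openin Z V \<and> F y\<^sub>0 \<subseteq> V \<longrightarrow>
        (\<exists>U. openin Y U \<and> y\<^sub>0 \<in> U \<and> (\<forall>y\<in>U. F y \<subseteq> V)))"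

abbreviation weakly_upper_hemicontinuous ::
  "('y::topological_space \<Rightarrow> 'x::real_normed_vector set) \<Rightarrow> bool" where
  "weakly_upper_hemicontinuous \<equiv> upper_hemicontinuous euclidean weak_topology"

end

theory Submission
  imports Defs "HOL-Library.Diagonal_Subsequence"
begin

text \<open>Nowhere equivalence says that every event splits into pieces whose conditional probabilities
  given \<open>\<F>\<close> are comparable and smaller, so by an exhaustion argument (Maharam) every admissible
  \<open>\<F>\<close>-conditional mass is attained by an event. Given random elements \<open>f\<^sub>n\<close>, possibly on
  an extension of \<open>T\<close>, one codes \<open>f\<^sub>n\<close> by countably many bits \<open>f\<^sub>n \<in> A\<^sub>j\<close>, where the
  \<open>A\<^sub>j\<close> are rational half-spaces of a norming sequence of functionals and integer balls. Since
  \<open>\<F>\<close> is countably generated, along a subsequence the joint conditional laws of the bits converge, and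
  the limit is realized by events \<open>C\<^sub>j\<close> of \<open>T\<close>. Weak compactness of the values turns
  the events \<open>C\<^sub>j\<close> into a selection \<open>h\<close> whose conditional law is the limit of those of \<open>f\<^sub>n\<close>.
  Applied to a constant sequence on \<open>T \<times> {True, False}\<close> this gives convexity, and applied to
  sequences of selections it gives weak compactness and upper hemicontinuity. The closed convex hull
  is handled by separation together with a measurable selection of nearly maximal points.\<close>

section \<open>Sublinear functionals and separation\<close>

text \<open>Two obstacles shape the proof. Weakly compact values need not be norm compact, so
  tightness in norm may fail for a sequence of selections, and a limit law on \<open>X\<close>
  cannot be drawn from it. The limit is therefore kept as a table of numbers, the masses of finitely
  coded cells over events of \<open>\<F>\<close>, and a point is recovered in each value separately
  from its weak compactness. Masses converge against events of \<open>\<F>\<close> only; hence the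
  set of \<open>t\<close> whose value misses a closed cell has to belong to \<open>\<F>\<close>, and
  this is where measurability of the correspondences for \<open>\<F>\<close> enters. The second
  obstacle is that bits lose their boundaries in the limit. For half-spaces both sides have weakly
  closed enlargements, and the boundary is invisible to convergence in distribution. For balls only
  the inside is weakly closed in general, so norms yield just one inequality between tails; it makes
  the limit integrable in the convexity statement, where no integrable bound is assumed.\<close>

definition sublinear :: "('x::real_vector \<Rightarrow> real) \<Rightarrow> bool" where
  "sublinear q \<longleftrightarrow> (\<forall>x y. q (x + y) \<le> q x + q y) \<and> (\<forall>a x. 0 \<le> a \<longrightarrow> q (a *\<^sub>R x) = a * q x)"

lemma sublinear_add: "sublinear q \<Longrightarrow> q (x + y) \<le> q x + q y"
  and sublinear_scale: "sublinear q \<Longrightarrow> 0 \<le> a \<Longrightarrow> q (a *\<^sub>R x) = a * q x"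
  by (auto simp: sublinear_def)

lemma sublinear_zero: "sublinear q \<Longrightarrow> q 0 = 0"
  using sublinear_scale[of q 0 0] by simp

lemma sublinear_ge: "sublinear q \<Longrightarrow> - q (- x) \<le> q x"
  using sublinear_add[of q x "- x"] sublinear_zero[of q] by simp

lemma sublinear_norm: "sublinear (norm :: 'x::real_normed_vector \<Rightarrow> real)"
  by (auto simp: sublinear_def norm_triangle_ineq)

text \<open>Applying the third hypothesis to \<open>inverse a\<close> and
  \<open>a *\<^sub>R x\<close> gives the reverse inequality, so homogeneity has to be checked in one
  direction only.\<close>

lemma sublinearI:
  assumes "\<And>x y. q (x + y) \<le> q x + q y" and "q 0 = 0"
    and "\<And>a x. 0 < a \<Longrightarrow> q (a *\<^sub>R x) \<le> a * q x"
  shows "sublinear q"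
  unfolding sublinear_def
proof (intro conjI allI impI)
  fix a :: real and x assume a: "0 \<le> a"
  show "q (a *\<^sub>R x) = a * q x"
  proof (cases "a = 0")
    case False
    then have "q (inverse a *\<^sub>R (a *\<^sub>R x)) \<le> inverse a * q (a *\<^sub>R x)"
      using a by (intro assms(3)) simp
    then have "a * q x \<le> q (a *\<^sub>R x)"
      using a False by (simp add: field_simps)
    with assms(3)[of a x] a False show ?thesis by simp
  qed (use assms(2) in simp)
qed (rule assms(1))

text \<open>With \<open>q\<close> the norm this yields separation from \<open>C\<close>; with \<open>C\<close> a singleton it shows that
  minimal sublinear functionals are linear.\<close>
lemma sublinear_lower:
  fixes q :: "'x::real_vector \<Rightarrow> real"
  assumes q: "sublinear q" and C: "convex C" "C \<noteq> {}" and d: "\<And>c. c \<in> C \<Longrightarrow> d \<le> q c"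
  obtains q' where "sublinear q'" "\<And>x. q' x \<le> q x" "\<And>c. c \<in> C \<Longrightarrow> q' (- c) \<le> - d"
proof -
  \<comment> \<open>\<open>q'\<close> is the greatest sublinear functional below \<open>q\<close>
    with values at most \<open>- d\<close> on \<open>- C\<close>: any such \<open>p\<close>
    satisfies \<open>p x \<le> p (x + l *\<^sub>R c) + l * p (- c)\<close>, which is at most
    \<open>P x (l, c)\<close>.\<close>
  define P where "P x = (\<lambda>(l, c). q (x + l *\<^sub>R c) - l * d)" for x
  define I where "I = {0::real..} \<times> C"
  define q' where "q' x = Inf (P x ` I)" for x
  have ne: "I \<noteq> {}" using C by (auto simp: I_def)
  \<comment> \<open>The bound \<open>d \<le> q c\<close> keeps the infimum finite.\<close>
  have lb: "- q (- x) \<le> P x i" if iI: "i \<in> I" for x i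
  proof -
    obtain l c where i: "i = (l, c)" and l: "0 \<le> l" and c: "c \<in> C" using iI by (auto simp: I_def)
    have "l * d \<le> l * q c" using l d[OF c] by (rule mult_left_mono[rotated])
    also have "\<dots> = q (- x + (x + l *\<^sub>R c))" using sublinear_scale[OF q l] by simp
    also have "\<dots> \<le> q (- x) + q (x + l *\<^sub>R c)" by (rule sublinear_add[OF q])
    finally show ?thesis by (simp add: P_def i)
  qed
  have bdd: "bdd_below (P x ` I)" for x
    using lb by (intro bdd_belowI2[where m = "- q (- x)"])
  have le: "q' x \<le> P x i" if "i \<in> I" for x i
    unfolding q'_def using bdd that by (intro cInf_lower) auto
  have ge: "m \<le> q' x" if "\<And>i. i \<in> I \<Longrightarrow> m \<le> P x i" for m x
    unfolding q'_def using ne that by (intro cInf_greatest) auto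
  obtain c0 where c0: "c0 \<in> C" using C by blast
  have q'q: "q' x \<le> q x" for x
    using le[of "(0, c0)" x] c0 by (simp add: P_def I_def)
  have add: "q' (x + y) \<le> q' x + q' y" for x y
  proof -
    have *: "q' (x + y) \<le> P x i + P y j" if ij: "i \<in> I" "j \<in> I" for i j
    proof -
      obtain l c m e where i: "i = (l, c)" and j: "j = (m, e)" and l: "0 \<le> l" "0 \<le> m"
        and c: "c \<in> C" "e \<in> C" using ij by (auto simp: I_def)
      \<comment> \<open>Convexity merges two rays: the weighted mean of \<open>c\<close> and
        \<open>e\<close> is the direction for the combined weight \<open>l + m\<close>.\<close>
      have "\<exists>f\<in>C. (l + m) *\<^sub>R f = l *\<^sub>R c + m *\<^sub>R e"
      proof (cases "l + m = 0")
        case True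
        then have "l = 0" "m = 0" using l by auto
        then show ?thesis using c by auto
      next
        case False
        then have "(l / (l + m)) *\<^sub>R c + (m / (l + m)) *\<^sub>R e \<in> C"
          using C(1) c l by (intro convexD) (auto simp: field_simps add_divide_distrib[symmetric])
        moreover have "(l + m) *\<^sub>R ((l / (l + m)) *\<^sub>R c + (m / (l + m)) *\<^sub>R e) = l *\<^sub>R c + m *\<^sub>R e"
          using False by (simp add: scaleR_add_right)
        ultimately show ?thesis by blast
      qed
      then obtain f where f: "f \<in> C" "(l + m) *\<^sub>R f = l *\<^sub>R c + m *\<^sub>R e" by blast
      have "q' (x + y) \<le> P (x + y) (l + m, f)"
        using l f by (intro le) (auto simp: I_def)
      also have "\<dots> = q ((x + l *\<^sub>R c) + (y + m *\<^sub>R e)) - (l + m) * d"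
        by (simp add: P_def f add_ac)
      also have "\<dots> \<le> P x i + P y j"
        using sublinear_add[OF q, of "x + l *\<^sub>R c" "y + m *\<^sub>R e"]
        by (simp add: P_def i j algebra_simps)
      finally show ?thesis .
    qed
    have "q' (x + y) - P x i \<le> q' y" if "i \<in> I" for i
      using *[OF that] by (intro ge) (simp add: algebra_simps)
    then have "q' (x + y) - q' y \<le> q' x"
      by (intro ge) (simp add: algebra_simps)
    then show ?thesis by simp
  qed
  have scale: "q' (a *\<^sub>R x) \<le> a * q' x" if a: "0 < a" for a x
  proof -
    have "inverse a * q' (a *\<^sub>R x) \<le> q' x"
    proof (rule ge)
      fix i assume "i \<in> I"
      then obtain l c where i: "i = (l, c)" and l: "0 \<le> l" and c: "c \<in> C" by (auto simp: I_def)
      have "q' (a *\<^sub>R x) \<le> P (a *\<^sub>R x) (a * l, c)"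
        using a l c by (intro le) (auto simp: I_def)
      also have "\<dots> = q (a *\<^sub>R (x + l *\<^sub>R c)) - a * l * d"
        by (simp add: P_def scaleR_add_right)
      also have "\<dots> = a * P x i"
        using a sublinear_scale[OF q, of a "x + l *\<^sub>R c"] by (simp add: P_def i right_diff_distrib)
      finally show "inverse a * q' (a *\<^sub>R x) \<le> P x i"
        using a by (simp add: field_simps)
    qed
    then show ?thesis using a by (simp add: field_simps)
  qed
  have zero: "q' 0 = 0"
  proof (rule antisym)
    show "q' 0 \<le> 0" using q'q[of 0] sublinear_zero[OF q] by simp
    show "0 \<le> q' 0" using lb[of _ 0] sublinear_zero[OF q] by (intro ge) auto
  qed
  have "q' (- c) \<le> - d" if "c \<in> C" for c
    using le[of "(1, c)" "- c"] that sublinear_zero[OF q] by (simp add: P_def I_def)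
  with q'q show ?thesis using that[of q'] sublinearI[of q'] add scale zero by blast
qed

text \<open>Hahn-Banach by descent instead of extension: Zorn's lemma yields a minimal sublinear
  functional below \<open>q\<close>, and lowering it along a single \<open>y\<close> shows that it
  is odd, hence linear. Chains have lower bounds because every member stays above
  \<open>- q (- x)\<close> at \<open>x\<close>.\<close>

lemma sublinear_dominates_linear:
  fixes q :: "'x::real_vector \<Rightarrow> real"
  assumes "sublinear q"
  obtains \<phi> where "linear \<phi>" "\<And>x. \<phi> x \<le> q x"
proof -
  define A where "A = {p. sublinear p \<and> (\<forall>x. p x \<le> q x)}"
  have "\<exists>m\<in>A. \<forall>a\<in>A. a \<le> m \<longrightarrow> a = m"
  proof (rule predicate_Zorn[where P = "\<lambda>a b. b \<le> a", simplified])
    show "partial_order_on A (relation_of (\<lambda>a b. b \<le> a) A)"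
      by (rule partial_order_on_relation_ofI) auto
  next
    fix K assume K: "K \<in> Chains (relation_of (\<lambda>a b. b \<le> a) A)"
    have KA: "K \<subseteq> A" and tot: "\<And>a b. a \<in> K \<Longrightarrow> b \<in> K \<Longrightarrow> a \<le> b \<or> b \<le> a"
      using K by (auto simp: Chains_def relation_of_def)
    show "\<exists>u\<in>A. \<forall>a\<in>K. u \<le> a"
    proof (cases "K = {}")
      case True
      then show ?thesis using assms by (auto simp: A_def)
    next
      case False
      define u where "u x = Inf ((\<lambda>p. p x) ` K)" for x
      have lb: "- q (- x) \<le> p x" if "p \<in> K" for p x
      proof -
        have "sublinear p" "p (- x) \<le> q (- x)" using that KA by (auto simp: A_def)
        then show ?thesis using sublinear_ge[of p x] by linarith
      qed
      have le: "u x \<le> p x" if "p \<in> K" for p x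
        unfolding u_def using that lb
        by (intro cInf_lower bdd_belowI2[where m = "- q (- x)"]) auto
      have ge: "m \<le> u x" if "\<And>p. p \<in> K \<Longrightarrow> m \<le> p x" for m x
        unfolding u_def using False that by (intro cInf_greatest) auto
      obtain p0 where p0: "p0 \<in> K" using False by blast
      have "sublinear u"
      proof (rule sublinearI)
        fix x y
        have *: "u (x + y) \<le> p x + r y" if pr: "p \<in> K" "r \<in> K" for p r
        proof -
          \<comment> \<open>Subadditivity of the pointwise infimum needs one functional below both
            \<open>p\<close> and \<open>r\<close>; the chain supplies it.\<close>
          obtain s where s: "s \<in> K" "s \<le> p" "s \<le> r" using tot[OF pr] pr by blast
          have "u (x + y) \<le> s (x + y)" by (rule le) fact
          also have "\<dots> \<le> s x + s y" using s KA by (intro sublinear_add) (auto simp: A_def)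
          also have "\<dots> \<le> p x + r y" using s by (intro add_mono) (auto simp: le_fun_def)
          finally show ?thesis .
        qed
        have "u (x + y) - p x \<le> u y" if "p \<in> K" for p
          using *[OF that] by (intro ge) (simp add: algebra_simps)
        then have "u (x + y) - u y \<le> u x" by (intro ge) (simp add: algebra_simps)
        then show "u (x + y) \<le> u x + u y" by simp
      next
        have "p 0 = 0" if "p \<in> K" for p using that KA sublinear_zero by (auto simp: A_def)
        then show "u 0 = 0" using le[OF p0, of 0] ge[of 0 0] p0 by force
      next
        fix a :: real and x assume a: "0 < a"
        have "inverse a * u (a *\<^sub>R x) \<le> u x"
        proof (rule ge)
          fix p assume p: "p \<in> K"
          have "u (a *\<^sub>R x) \<le> p (a *\<^sub>R x)" by (rule le) fact
          also have "\<dots> = a * p x" using p KA a by (intro sublinear_scale) (auto simp: A_def)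
          finally show "inverse a * u (a *\<^sub>R x) \<le> p x" using a by (simp add: field_simps)
        qed
        then show "u (a *\<^sub>R x) \<le> a * u x" using a by (simp add: field_simps)
      qed
      moreover have "u x \<le> q x" for x using le[OF p0, of x] p0 KA by (force simp: A_def intro: order_trans)
      ultimately have "u \<in> A" by (auto simp: A_def)
      then show ?thesis using le by (auto simp: le_fun_def)
    qed
  qed
  then obtain m where mA: "m \<in> A" and min: "\<And>a. a \<in> A \<Longrightarrow> a \<le> m \<Longrightarrow> a = m" by blast
  have m: "sublinear m" "\<And>x. m x \<le> q x" using mA by (auto simp: A_def)
  have neg: "m (- y) = - m y" for y
  proof -
    obtain q' where q': "sublinear q'" "\<And>x. q' x \<le> m x" "q' (- y) \<le> - m y"
      using sublinear_lower[OF m(1), of "{y}" "m y"] by auto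
    have "q' \<in> A" using q' m(2) by (auto simp: A_def intro: order_trans)
    then have "q' = m" using q'(2) by (intro min) (auto simp: le_fun_def)
    then show ?thesis using q'(3) sublinear_ge[OF m(1), of "- y"] by simp
  qed
  have "linear m"
  proof (rule linearI)
    fix x y
    have "- m (x + y) \<le> - m x - m y"
      using sublinear_add[OF m(1), of "- x" "- y"] neg[of "x + y"] neg[of x] neg[of y] by simp
    then show "m (x + y) = m x + m y" using sublinear_add[OF m(1), of x y] by simp
  next
    fix a x
    show "m (a *\<^sub>R x) = a *\<^sub>R m x"
    proof (cases "0 \<le> a")
      case False
      then have "m ((- a) *\<^sub>R x) = - a * m x" by (intro sublinear_scale m) simp
      then show ?thesis using neg[of "a *\<^sub>R x"] by simp
    qed (simp add: sublinear_scale m)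
  qed
  then show ?thesis using m(2) that by blast
qed

text \<open>The norm is lowered along the differences \<open>x - c\<close>, so that a linear
  functional below the result is at most \<open>- d\<close> at \<open>c - x\<close>. Domination by
  the norm gives operator norm at most one, while the gap \<open>d\<close> is retained in full; the
  argument for closed convex hulls uses this uniform gap.\<close>

lemma hahn_banach_separation:
  fixes C :: "'x::real_normed_vector set"
  assumes "convex C" and "\<And>c. c \<in> C \<Longrightarrow> d \<le> norm (x - c)"
  obtains \<phi> :: "'x \<Rightarrow> real" where "bounded_linear \<phi>" "\<And>y. \<phi> y \<le> norm y"
    "\<And>c. c \<in> C \<Longrightarrow> \<phi> c + d \<le> \<phi> x"
proof (cases "C = {}")
  case True
  then show ?thesis using that[of "\<lambda>_. 0"] by simp
next
  case False
  have "convex ((\<lambda>c. x - c) ` C)"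
    using convex_translation[OF convex_negations[OF assms(1)], of x] by (simp add: image_image)
  then obtain q where q: "sublinear q" "\<And>y. q y \<le> norm y"
    "\<And>z. z \<in> (\<lambda>c. x - c) ` C \<Longrightarrow> q (- z) \<le> - d"
    using \<open>convex ((\<lambda>c. x - c) ` C)\<close> False assms(2)
    by (rule_tac sublinear_lower[OF sublinear_norm, of "(\<lambda>c. x - c) ` C" d]) auto
  obtain \<phi> where \<phi>: "linear \<phi>" "\<And>y. \<phi> y \<le> q y" using sublinear_dominates_linear[OF q(1)] by blast
  interpret linear \<phi> by fact
  have le: "\<phi> y \<le> norm y" for y using \<phi>(2) q(2) order_trans by blast
  have "norm (\<phi> y) \<le> norm y * 1" for y using le[of y] le[of "- y"] neg[of y] by simp
  then have "bounded_linear \<phi>" using \<phi>(1) unfolding linear_conv_bounded_linear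
    by (intro bounded_linear_intro[where K = 1] add) (auto simp: scale)
  moreover have "\<phi> c + d \<le> \<phi> x" if "c \<in> C" for c
    using order_trans[OF \<phi>(2) q(3)[OF imageI[OF that]]] by (simp add: diff neg)
  ultimately show ?thesis using le that by blast
qed

lemma norming_functional:
  fixes x :: "'x::real_normed_vector"
  shows "\<exists>\<phi> :: 'x \<Rightarrow> real. bounded_linear \<phi> \<and> (\<forall>y. \<phi> y \<le> norm y) \<and> norm x \<le> \<phi> x"
proof -
  obtain \<phi> :: "'x \<Rightarrow> real" where "bounded_linear \<phi>" "\<And>y. \<phi> y \<le> norm y"
    "\<And>c. c \<in> {0} \<Longrightarrow> \<phi> c + norm x \<le> \<phi> x"
    by (rule hahn_banach_separation[of "{0}" "norm x" x]) auto
  then show ?thesis using linear_simps(3)[of \<phi>] by (intro exI[of _ \<phi>]) auto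
qed

text \<open>Countably many functionals of norm at most one whose supremum is the norm. They serve as
  coordinates: being countable, they give an enumerable family of bits, and conditions on all of
  them stay measurable.\<close>

definition norming :: "(nat \<Rightarrow> 'x::real_normed_vector \<Rightarrow> real) \<Rightarrow> bool" where
  "norming \<phi> \<longleftrightarrow> (\<forall>k. bounded_linear (\<phi> k)) \<and> (\<forall>k x. \<phi> k x \<le> norm x) \<and>
     (\<forall>x e. 0 < e \<longrightarrow> (\<exists>k. norm x - e < \<phi> k x))"

lemma norming_exists:
  "\<exists>\<phi> :: nat \<Rightarrow> 'x::{real_normed_vector, second_countable_topology} \<Rightarrow> real. norming \<phi>"
proof -
  obtain D :: "'x set" where D: "countable D" "\<And>U. open U \<Longrightarrow> U \<noteq> {} \<Longrightarrow> \<exists>d\<in>D. d \<in> U"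
    using countable_dense_exists by blast
  have Dne: "D \<noteq> {}" using D(2)[of UNIV] by auto
  define d where "d = from_nat_into D"
  obtain \<Phi> :: "'x \<Rightarrow> 'x \<Rightarrow> real" where \<Phi>: "\<And>x. bounded_linear (\<Phi> x)"
    "\<And>x y. \<Phi> x y \<le> norm y" "\<And>x. norm x \<le> \<Phi> x x"
    using norming_functional by metis
  have "\<exists>k. norm x - e < \<Phi> (d k) x" if e: "0 < e" for x e
  proof -
    \<comment> \<open>Functionals that norm the points of a dense sequence suffice. Replacing
      \<open>x\<close> by a near point \<open>y\<close> costs their distance once in the norm and
      once in the functional, hence \<open>e/2\<close>.\<close>
    obtain y where y: "y \<in> D" "y \<in> ball x (e/2)" using D(2)[of "ball x (e/2)"] e by auto
    obtain k where k: "y = d k" unfolding d_def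
      using y(1) D(1) by (metis from_nat_into_to_nat_on)
    have "norm x \<le> norm y + norm (y - x)" using norm_triangle_ineq[of y "x - y"] by (simp add: norm_minus_commute)
    moreover have "\<Phi> y y - \<Phi> y x \<le> norm (y - x)"
      using \<Phi>(2)[of y "y - x"] linear_simps(2)[OF \<Phi>(1)] by metis
    moreover have "norm (y - x) < e / 2" using y(2) by (simp add: dist_norm norm_minus_commute)
    ultimately show ?thesis using \<Phi>(3)[of y] k by (intro exI[of _ k]) auto
  qed
  then have "norming (\<lambda>k. \<Phi> (d k))" using \<Phi>(1,2) by (simp add: norming_def)
  then show ?thesis by (rule exI[of norming])
qed

section \<open>The weak topology\<close>

lemma openin_weak_vimage:
  fixes \<phi> :: "'x::real_normed_vector \<Rightarrow> real"
  assumes "bounded_linear \<phi>" "open U"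
  shows "openin weak_topology (\<phi> -` U)"
  unfolding weak_topology_def by (intro topology_generated_by_Basis CollectI exI[of _ \<phi>] exI[of _ U] conjI refl assms)

lemma closedin_weak_vimage:
  fixes \<phi> :: "'x::real_normed_vector \<Rightarrow> real"
  assumes "bounded_linear \<phi>" "closed S"
  shows "closedin weak_topology (\<phi> -` S)"
  using openin_weak_vimage[OF assms(1), of "- S"] assms(2)
  by (simp add: closedin_def open_Compl vimage_Compl Compl_eq_Diff_UNIV[symmetric])

lemma openin_weak_imp_open:
  assumes "openin weak_topology V"
  shows "open V"
proof -
  have "generate_topology_on {\<phi> -` U |(\<phi> :: 'a \<Rightarrow> real) U. bounded_linear \<phi> \<and> open U} V"
    using assms unfolding weak_topology_def by (rule openin_topology_generated_by)
  then show ?thesis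
  proof (induction rule: generate_topology_on.induct)
    case (Basis s)
    then obtain \<phi> :: "'a \<Rightarrow> real" and U where "s = \<phi> -` U" "bounded_linear \<phi>" "open U" by blast
    then show ?case by (simp add: open_vimage linear_continuous_on)
  qed auto
qed

lemma closedin_weak_imp_closed: "closedin weak_topology S \<Longrightarrow> closed S"
  using openin_weak_imp_open[of "- S"]
  by (simp add: closedin_def closed_def Compl_eq_Diff_UNIV[symmetric])

text \<open>Convergence under every bounded functional is weak convergence: it gives the claim for
  subbasic sets, and induction over the generated topology carries it to finite intersections and
  unions.\<close>

lemma eventually_in_weak_open:
  fixes x :: "nat \<Rightarrow> 'x::real_normed_vector"
  assumes "openin weak_topology V" "a \<in> V"
    and "\<And>\<phi> :: 'x \<Rightarrow> real. bounded_linear \<phi> \<Longrightarrow> (\<lambda>n. \<phi> (x n)) \<longlonglongrightarrow> \<phi> a"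
  shows "\<forall>\<^sub>F n in sequentially. x n \<in> V"
proof -
  have "generate_topology_on {\<phi> -` U |(\<phi> :: 'x \<Rightarrow> real) U. bounded_linear \<phi> \<and> open U} V"
    using assms(1) unfolding weak_topology_def by (rule openin_topology_generated_by)
  then show ?thesis using assms(2)
  proof (induction rule: generate_topology_on.induct)
    case (Int s t)
    then show ?case by (simp add: eventually_conj_iff)
  next
    case (UN K)
    then obtain k where k: "k \<in> K" "a \<in> k" by blast
    then have "\<forall>\<^sub>F n in sequentially. x n \<in> k" by (rule UN.IH)
    then show ?case by (rule eventually_mono) (use k in blast)
  next
    case (Basis s)
    then obtain \<phi> :: "'x \<Rightarrow> real" and U where s: "s = \<phi> -` U" "bounded_linear \<phi>" "open U" by blast
    have "\<forall>\<^sub>F n in sequentially. \<phi> (x n) \<in> U"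
      using s Basis(2) by (intro topological_tendstoD[OF assms(3)]) auto
    then show ?case by (simp add: s(1))
  qed simp
qed

lemma separating_functional:
  fixes x y :: "'x::real_normed_vector"
  assumes "x \<noteq> y"
  obtains \<phi> :: "'x \<Rightarrow> real" where "bounded_linear \<phi>" "\<phi> x < \<phi> y"
proof -
  obtain \<phi> :: "'x \<Rightarrow> real" where "bounded_linear \<phi>" "norm (y - x) \<le> \<phi> (y - x)"
    using norming_functional[of "y - x"] by blast
  moreover have "0 < norm (y - x)" using assms by simp
  moreover have "\<phi> (y - x) = \<phi> y - \<phi> x" using linear_simps(2)[OF \<open>bounded_linear \<phi>\<close>] .
  ultimately have "\<phi> x < \<phi> y" by linarith
  with \<open>bounded_linear \<phi>\<close> show ?thesis by (rule that)
qed

lemma Hausdorff_space_weak_topology: "Hausdorff_space (weak_topology :: 'x::real_normed_vector topology)"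
  unfolding Hausdorff_space_def
proof (intro allI impI, elim conjE)
  fix x y :: 'x assume "x \<noteq> y"
  then obtain \<phi> :: "'x \<Rightarrow> real" where \<phi>: "bounded_linear \<phi>" "\<phi> x < \<phi> y" by (rule separating_functional)
  obtain c where c: "\<phi> x < c" "c < \<phi> y" using dense[OF \<phi>(2)] by blast
  have "openin weak_topology (\<phi> -` {..<c})" "openin weak_topology (\<phi> -` {c<..})"
    by (rule openin_weak_vimage[OF \<phi>(1)]; simp)+
  moreover have "x \<in> \<phi> -` {..<c}" "y \<in> \<phi> -` {c<..}" "disjnt (\<phi> -` {..<c}) (\<phi> -` {c<..})"
    using c by (auto simp: disjnt_def)
  ultimately show "\<exists>U V. openin weak_topology U \<and> openin weak_topology V \<and> x \<in> U \<and> y \<in> V \<and> disjnt U V"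
    by blast
qed

lemma weakly_compact_imp_closed:
  fixes S :: "'x::real_normed_vector set"
  assumes "compactin weak_topology S"
  shows "closed S"
  using compactin_imp_closedin[OF Hausdorff_space_weak_topology assms]
  by (rule closedin_weak_imp_closed)

text \<open>This turns compatibility with every finite initial segment of a bit sequence into one
  point compatible with all bits.\<close>

lemma weakly_compact_nested:
  assumes K: "compactin weak_topology K" and E: "\<And>m. closedin weak_topology (E m)"
    and dec: "decseq E" and ne: "\<And>m. K \<inter> E m \<noteq> {}"
  shows "\<exists>x\<in>K. \<forall>m. x \<in> E m"
proof -
  have fip: "K \<inter> \<Inter>\<U> \<noteq> {}" if "\<forall>C\<in>\<U>. closedin weak_topology C"
    "\<forall>\<F>. finite \<F> \<and> \<F> \<subseteq> \<U> \<longrightarrow> K \<inter> \<Inter>\<F> \<noteq> {}" for \<U>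
    using K[unfolded compactin_fip, THEN conjunct2, THEN spec, of \<U>] that by iprover
  have "K \<inter> \<Inter>(range E) \<noteq> {}"
  proof (rule fip)
    show "\<forall>C\<in>range E. closedin weak_topology C" using E by auto
    show "\<forall>\<F>. finite \<F> \<and> \<F> \<subseteq> range E \<longrightarrow> K \<inter> \<Inter>\<F> \<noteq> {}"
    proof (intro allI impI, elim conjE)
      fix \<F> assume "finite \<F>" "\<F> \<subseteq> range E"
      then obtain I where I: "finite I" "\<F> = E ` I" by (meson finite_subset_image)
      \<comment> \<open>Inserting 0 keeps the maximum meaningful for the empty subfamily.\<close>
      have "E (Max (insert 0 I)) \<subseteq> \<Inter>\<F>"
        unfolding I(2) using dec I(1) by (intro INT_greatest decseqD[OF dec]) simp
      then show "K \<inter> \<Inter>\<F> \<noteq> {}" using ne[of "Max (insert 0 I)"] by blast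
    qed
  qed
  then show ?thesis by auto
qed

text \<open>The norm topology is finer and second countable, so weakly open covers have countable
  subcovers; this replaces the Eberlein--Smulian theorem.\<close>
lemma weakly_sequentially_compact_imp_compact:
  fixes S :: "'x::{real_normed_vector, second_countable_topology} set"
  assumes seq: "\<And>x :: nat \<Rightarrow> 'x. (\<And>n. x n \<in> S) \<Longrightarrow> \<exists>r a. strict_mono r \<and> a \<in> S \<and>
      (\<forall>\<phi> :: 'x \<Rightarrow> real. bounded_linear \<phi> \<longrightarrow> (\<lambda>n. \<phi> (x (r n))) \<longlonglongrightarrow> \<phi> a)"
  shows "compactin weak_topology S"
  unfolding compactin_def
proof (intro conjI allI impI, simp, elim conjE)
  fix \<U> :: "'x set set"
  assume op: "\<forall>U\<in>\<U>. openin weak_topology U" and cov: "S \<subseteq> \<Union>\<U>"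
  obtain \<U>' where \<U>': "\<U>' \<subseteq> \<U>" "countable \<U>'" "\<Union>\<U>' = \<Union>\<U>"
  proof (rule Lindelof[of \<U>])
    show "open U" if "U \<in> \<U>" for U using op that openin_weak_imp_open by blast
  qed
  show "\<exists>\<F>. finite \<F> \<and> \<F> \<subseteq> \<U> \<and> S \<subseteq> \<Union>\<F>"
  proof (rule ccontr)
    assume no: "\<nexists>\<F>. finite \<F> \<and> \<F> \<subseteq> \<U> \<and> S \<subseteq> \<Union>\<F>"
    have ne: "\<U>' \<noteq> {}"
    proof
      assume "\<U>' = {}"
      then have "S \<subseteq> \<Union>{}" using cov unfolding \<U>'(3)[symmetric] by simp
      then have "finite {} \<and> {} \<subseteq> \<U> \<and> S \<subseteq> \<Union>{}" by simp
      then show False using no by metis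
    qed
    define U where "U = from_nat_into \<U>'"
    have U: "range U = \<U>'" unfolding U_def using ne \<U>'(2) by (rule range_from_nat_into)
    have "\<exists>x. x \<in> S \<and> x \<notin> \<Union>(U ` {..n})" for n
    proof -
      have "finite (U ` {..n})" "U ` {..n} \<subseteq> \<U>" using U \<U>'(1) by auto
      then have "\<not> S \<subseteq> \<Union>(U ` {..n})" using no by metis
      then show ?thesis by blast
    qed
    \<comment> \<open>Each \<open>x n\<close> avoids the first \<open>n + 1\<close> members of the
      cover. A weak limit of a subsequence lies in some \<open>U m\<close>, which the sequence
      avoids from index \<open>m\<close> on.\<close>
    then obtain x where x: "\<And>n. x n \<in> S" "\<And>n. x n \<notin> \<Union>(U ` {..n})" by metis
    from seq[of x, OF x(1)] obtain r a where ra: "strict_mono r" "a \<in> S"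
      "\<forall>\<phi> :: 'x \<Rightarrow> real. bounded_linear \<phi> \<longrightarrow> (\<lambda>n. \<phi> (x (r n))) \<longlonglongrightarrow> \<phi> a"
      by (elim exE conjE) (rule that)
    obtain m where m: "a \<in> U m" 
      using ra(2) cov unfolding \<U>'(3)[symmetric] U[symmetric] by blast
    have "openin weak_topology (U m)" using op \<U>'(1) U by blast
    then have "\<forall>\<^sub>F n in sequentially. x (r n) \<in> U m"
      using m ra(3)[rule_format] by (rule eventually_in_weak_open[where x = "\<lambda>n. x (r n)"])
    then obtain N where N: "\<And>n. n \<ge> N \<Longrightarrow> x (r n) \<in> U m"
      unfolding eventually_sequentially by blast
    define n where "n = max m N"
    have n: "n \<ge> m" "x (r n) \<in> U m" using N[of n] by (auto simp: n_def)
    have "m \<le> r n" using n(1) seq_suble[OF ra(1), of n] by simp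
    then show False using x(2)[of "r n"] n(2) by auto
  qed
qed

text \<open>Following Kuratowski and Ryll-Nardzewski, \<open>u n\<close> takes values in a dense sequence and
  stays within \<open>2\<^sup>-\<^sup>n\<close> of the values of the correspondence.\<close>
lemma measurable_selection:
  fixes F :: "'t \<Rightarrow> 'x::{banach, second_countable_topology} set"
  assumes F: "\<And>E. closed E \<Longrightarrow> {t \<in> space M. F t \<inter> E \<noteq> {}} \<in> sets M"
    and ne: "\<And>t. t \<in> space M \<Longrightarrow> F t \<noteq> {}"
  obtains f where "f \<in> borel_measurable M" "\<And>t. t \<in> space M \<Longrightarrow> f t \<in> closure (F t)"
proof -
  obtain D :: "'x set" where D: "countable D" "\<And>U. open U \<Longrightarrow> U \<noteq> {} \<Longrightarrow> \<exists>d\<in>D. d \<in> U"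
    using countable_dense_exists by blast
  have Dne: "D \<noteq> {}" using D(2)[of UNIV] by auto
  define d where "d = from_nat_into D"
  have dense: "\<exists>i. d i \<in> ball x e" if e: "0 < e" for x e
  proof -
    obtain y where y: "y \<in> D" "y \<in> ball x e" using D(2)[of "ball x e"] e by auto
    with from_nat_into_surj[OF D(1) y(1)] show ?thesis by (auto simp: d_def)
  qed
  \<comment> \<open>Measurability is given for closed sets, so an open ball is exhausted by
    countably many closed ones.\<close>
  have op: "{t \<in> space M. F t \<inter> ball x e \<noteq> {}} \<in> sets M" for x e
  proof -
    have "ball x e = (\<Union>n::nat. cball x (e - 1 / Suc n))"
    proof (intro equalityI subsetI)
      fix y assume "y \<in> ball x e"
      then have "0 < e - dist x y" by simp
      from nat_approx_posE[OF this] obtain n where "1 / real (Suc n) < e - dist x y" by blast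
      then have "y \<in> cball x (e - 1 / Suc n)" by simp
      then show "y \<in> (\<Union>n::nat. cball x (e - 1 / Suc n))" by blast
    next
      fix y assume "y \<in> (\<Union>n::nat. cball x (e - 1 / Suc n))"
      then obtain n :: nat where "dist x y \<le> e - 1 / Suc n" by auto
      moreover have "0 < 1 / real (Suc n)" by simp
      ultimately show "y \<in> ball x e" unfolding mem_ball by linarith
    qed
    then have "{t \<in> space M. F t \<inter> ball x e \<noteq> {}}
        = (\<Union>n::nat. {t \<in> space M. F t \<inter> cball x (e - 1 / Suc n) \<noteq> {}})" by auto
    then show ?thesis using F by auto
  qed
  define e :: "nat \<Rightarrow> real" where "e n = (1/2) ^ n" for n
  have e: "0 < e n" for n by (simp add: e_def)
  \<comment> \<open>The radius \<open>2 * e n\<close> absorbs \<open>e n + e (Suc n)\<close>: a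
    point of \<open>F t\<close> within \<open>e n\<close> of \<open>u n t\<close>, then a dense
    point within \<open>e (Suc n)\<close> of that. It makes the increments summable, and taking the
    least admissible index keeps \<open>u\<close> measurable.\<close>
  define Q where "Q i n t x \<longleftrightarrow> F t \<inter> ball (d i) (e (Suc n)) \<noteq> {} \<and> dist x (d i) < 2 * e n" for i n t x
  define u where "u = rec_nat (\<lambda>t. d (LEAST i. F t \<inter> ball (d i) (e 0) \<noteq> {}))
     (\<lambda>n v t. d (LEAST i. Q i n t (v t)))"
  have u0: "u 0 t = d (LEAST i. F t \<inter> ball (d i) (e 0) \<noteq> {})" for t by (simp add: u_def)
  have uS: "u (Suc n) t = d (LEAST i. Q i n t (u n t))" for n t by (simp add: u_def)
  have near: "F t \<inter> ball (u n t) (e n) \<noteq> {} \<and> (0 < n \<longrightarrow> dist (u (n - 1) t) (u n t) < 2 * e (n - 1))"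
    if t: "t \<in> space M" for n t
  proof (induction n)
    case 0
    obtain x where x: "x \<in> F t" using ne[OF t] by blast
    obtain i where "d i \<in> ball x (e 0)" using dense[OF e] by blast
    then have "F t \<inter> ball (d i) (e 0) \<noteq> {}" using x by (auto simp: dist_commute)
    then have "F t \<inter> ball (u 0 t) (e 0) \<noteq> {}"
      unfolding u0 by (rule LeastI[of "\<lambda>i. F t \<inter> ball (d i) (e 0) \<noteq> {}"])
    then show ?case by simp
  next
    case (Suc n)
    then obtain x where x: "x \<in> F t" "dist (u n t) x < e n" by auto
    obtain i where i: "d i \<in> ball x (e (Suc n))" using dense[OF e] by blast
    have "dist (u n t) (d i) \<le> dist (u n t) x + dist x (d i)" by (rule dist_triangle)
    also have "\<dots> < e n + e (Suc n)" using x i by auto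
    also have "\<dots> \<le> 2 * e n" by (simp add: e_def)
    finally have "Q i n t (u n t)" using x i by (auto simp: Q_def dist_commute)
    then have "Q (LEAST i. Q i n t (u n t)) n t (u n t)" by (rule LeastI)
    then show ?case unfolding uS Q_def by (simp add: dist_commute uS)
  qed
  have meas: "u n \<in> borel_measurable M" for n
  proof (induction n)
    case 0
    have "(\<lambda>t. LEAST i. F t \<inter> ball (d i) (e 0) \<noteq> {}) \<in> measurable M (count_space UNIV)"
      using op unfolding pred_def by (intro measurable_Least) (simp add: pred_def)
    then show ?case unfolding u0[abs_def] by measurable
  next
    case (Suc n)
    have "{t \<in> space M. dist (u n t) (d i) < 2 * e n} \<in> sets M" for i
      using Suc by measurable
    then have "Measurable.pred M (\<lambda>t. Q i n t (u n t))" for i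
      unfolding Q_def pred_def by (intro sets.sets_Collect_conj op)
    then have "(\<lambda>t. LEAST i. Q i n t (u n t)) \<in> measurable M (count_space UNIV)"
      by (intro measurable_Least)
    then show ?case unfolding uS[abs_def] by measurable
  qed
  have step: "norm (u (Suc n) t - u n t) < 2 * e n" if "t \<in> space M" for n t
    using near[OF that, of "Suc n"] by (simp add: dist_norm norm_minus_commute)
  define f where "f t = lim (\<lambda>n. u n t)" for t
  have lim: "(\<lambda>n. u n t) \<longlonglongrightarrow> f t" if "t \<in> space M" for t
  proof -
    have "summable (\<lambda>n. u (Suc n) t - u n t)"
    proof (rule summable_comparison_test')
      show "summable (\<lambda>n. 2 * e n)" unfolding e_def by (intro summable_mult summable_geometric) simp
      show "norm (u (Suc n) t - u n t) \<le> 2 * e n" if "n \<ge> 0" for n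
        using step[OF \<open>t \<in> space M\<close>, of n] by simp
    qed
    then have "convergent (\<lambda>n. (\<Sum>i<n. u (Suc i) t - u i t))" by (simp add: summable_iff_convergent)
    then have "convergent (\<lambda>n. u n t - u 0 t)" by (simp only: sum_lessThan_telescope[where f = "\<lambda>i. u i t"])
    then have "convergent (\<lambda>n. u n t - u 0 t + u 0 t)" by (intro convergent_add convergent_const)
    then show ?thesis unfolding f_def by (simp add: convergent_LIMSEQ_iff)
  qed
  have "f \<in> borel_measurable M" using lim meas by (rule borel_measurable_LIMSEQ_metric[rotated])
  moreover have "f t \<in> closure (F t)" if t: "t \<in> space M" for t
    unfolding closure_approachable
  proof (intro allI impI)
    fix c :: real assume c: "0 < c"
    have "e \<longlonglongrightarrow> 0" unfolding e_def[abs_def] by (intro LIMSEQ_realpow_zero) auto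
    then have "\<forall>\<^sub>F n in sequentially. e n < c / 2" using c by (intro order_tendstoD) auto
    moreover have "\<forall>\<^sub>F n in sequentially. dist (u n t) (f t) < c / 2"
      using c lim[OF t] by (intro tendstoD) auto
    ultimately have "\<forall>\<^sub>F n in sequentially. e n < c / 2 \<and> dist (u n t) (f t) < c / 2"
      by (rule eventually_conj)
    then obtain n where n: "e n < c / 2" "dist (u n t) (f t) < c / 2"
      using eventually_happens'[OF sequentially_bot] by blast
    obtain x where "x \<in> F t" "dist (u n t) x < e n" using near[OF t, of n] by auto
    then show "\<exists>y\<in>F t. dist y (f t) < c"
      using n dist_triangle3[of x "f t" "u n t"] by (intro bexI[of _ x]) auto
  qed
  ultimately show ?thesis by (rule that)
qed

section \<open>Events with prescribed conditional probabilities\<close>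

text \<open>A finite measure kept as a plain real-valued set function, so that conditional masses
  such as \<open>\<lambda>D. prob (E \<inter> D)\<close>, their sums, multiples and limits are
  compared directly.\<close>

definition real_measure :: "'t set set \<Rightarrow> ('t set \<Rightarrow> real) \<Rightarrow> bool" where
  "real_measure \<F> \<mu> \<longleftrightarrow> (\<forall>D\<in>\<F>. 0 \<le> \<mu> D) \<and>
     (\<forall>A :: nat \<Rightarrow> 't set. range A \<subseteq> \<F> \<longrightarrow> disjoint_family A \<longrightarrow> (\<lambda>i. \<mu> (A i)) sums \<mu> (\<Union>i. A i))"

lemma real_measureI:
  assumes "\<And>D. D \<in> \<F> \<Longrightarrow> 0 \<le> \<mu> D"
    and "\<And>A :: nat \<Rightarrow> 't set. range A \<subseteq> \<F> \<Longrightarrow> disjoint_family A \<Longrightarrow> (\<lambda>i. \<mu> (A i)) sums \<mu> (\<Union>i. A i)"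
  shows "real_measure \<F> \<mu>"
  using assms by (auto simp: real_measure_def)

lemma real_measure_nonneg: "real_measure \<F> \<mu> \<Longrightarrow> D \<in> \<F> \<Longrightarrow> 0 \<le> \<mu> D"
  and real_measure_sums: "real_measure \<F> \<mu> \<Longrightarrow> range A \<subseteq> \<F> \<Longrightarrow> disjoint_family A \<Longrightarrow>
    (\<lambda>i. \<mu> (A i)) sums \<mu> (\<Union>i. A i)" for A :: "nat \<Rightarrow> 't set"
  by (auto simp: real_measure_def)

lemma real_measure_add: "real_measure \<F> \<mu> \<Longrightarrow> real_measure \<F> \<nu> \<Longrightarrow> real_measure \<F> (\<lambda>D. \<mu> D + \<nu> D)"
  by (auto simp: real_measure_def intro!: sums_add)

lemma real_measure_cmult: "real_measure \<F> \<mu> \<Longrightarrow> 0 \<le> c \<Longrightarrow> real_measure \<F> (\<lambda>D. c * \<mu> D)"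
  by (auto simp: real_measure_def intro!: sums_mult)

lemma (in finite_measure) real_measure_Int:
  assumes "\<F> \<subseteq> sets M" "E \<in> sets M"
  shows "real_measure \<F> (\<lambda>D. measure M (E \<inter> D))"
proof (rule real_measureI)
  fix A :: "nat \<Rightarrow> 'a set" assume A: "range A \<subseteq> \<F>" "disjoint_family A"
  have "A i \<in> sets M" for i using A(1) assms(1) by blast
  then have "(\<lambda>i. measure M (E \<inter> A i)) sums measure M (\<Union>i. E \<inter> A i)"
    using A(2) assms(2) by (intro finite_measure_UNION) (auto simp: disjoint_family_on_def)
  then show "(\<lambda>i. measure M (E \<inter> A i)) sums measure M (E \<inter> (\<Union>i. A i))" by simp
qed simp

lemma (in finite_measure) measure_split:
  "A \<in> sets M \<Longrightarrow> B \<in> sets M \<Longrightarrow> A \<inter> B = {} \<Longrightarrow> S = A \<union> B \<Longrightarrow>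
    measure M S = measure M A + measure M B"
  by (simp add: finite_measure_Union)

context sigma_algebra
begin

lemma real_measure_empty:
  assumes "real_measure M \<mu>" shows "\<mu> {} = 0"
proof -
  have "(\<lambda>i. \<mu> {}) sums \<mu> (\<Union>i::nat. {})"
    using assms by (intro real_measure_sums[of M \<mu> "\<lambda>_. {}"]) (auto simp: disjoint_family_on_def)
  then have "(\<lambda>i::nat. \<mu> {}) \<longlonglongrightarrow> 0" by (intro summable_LIMSEQ_zero sums_summable)
  then show ?thesis by (simp add: LIMSEQ_const_iff)
qed

lemma real_measure_Un:
  assumes "real_measure M \<mu>" "A \<in> M" "B \<in> M" "A \<inter> B = {}"
  shows "\<mu> (A \<union> B) = \<mu> A + \<mu> B"
proof -
  have "(\<lambda>i. \<mu> (binaryset A B i)) sums \<mu> (\<Union>i. binaryset A B i)"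
    using assms by (intro real_measure_sums[of M]) (auto simp: range_binaryset_eq disjoint_family_on_def binaryset_def)
  moreover have "(\<lambda>i. \<mu> (binaryset A B i)) sums (\<mu> A + \<mu> B)"
    by (intro binaryset_sums real_measure_empty assms)
  ultimately show ?thesis by (simp add: UN_binaryset_eq sums_unique2)
qed

text \<open>The Hahn decomposition of two finite measures, read back in real terms. It replaces a
  comparison of conditional densities: \<open>g\<close> dominates on every measurable part of
  \<open>Y\<close>, and \<open>f\<close> on every measurable set disjoint from it.\<close>

lemma real_measure_hahn:
  assumes f: "real_measure M f" and g: "real_measure M g"
  obtains Y where "Y \<in> M" "\<And>X. X \<in> M \<Longrightarrow> X \<subseteq> Y \<Longrightarrow> f X \<le> g X"
    "\<And>X. X \<in> M \<Longrightarrow> X \<inter> Y = {} \<Longrightarrow> g X \<le> f X"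
proof -
  define K where "K h = measure_of \<Omega> M (\<lambda>D. ennreal (h D))" for h :: "'a set \<Rightarrow> real"
  have sets: "sets (K h) = M" and space: "space (K h) = \<Omega>" for h by (simp_all add: K_def)
  have em: "emeasure (K h) D = ennreal (h D)" if "real_measure M h" "D \<in> M" for h D
    unfolding K_def
  proof (rule emeasure_measure_of_sigma[OF sigma_algebra_axioms _ _ that(2)])
    show "positive M (\<lambda>D. ennreal (h D))" using real_measure_empty[OF that(1)] by (simp add: positive_def)
    show "countably_additive M (\<lambda>D. ennreal (h D))"
      unfolding countably_additive_def
    proof (intro allI impI)
      fix A :: "nat \<Rightarrow> 'a set" assume A: "range A \<subseteq> M" "disjoint_family A" "(\<Union>i. A i) \<in> M"
      show "(\<Sum>i. ennreal (h (A i))) = ennreal (h (\<Union>i. A i))"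
        using real_measure_sums[OF that(1) A(1,2)] real_measure_nonneg[OF that(1)] A(1)
        by (intro suminf_ennreal_eq) auto
    qed
  qed
  have fin: "finite_measure (K h)" if "real_measure M h" for h
    using em[OF that top] by (intro finite_measureI) (simp add: space)
  have "sets (K f) = sets (K g)" by (simp only: sets)
  from finite_unsigned_Hahn_decomposition[OF fin[OF g] fin[OF f] this]
  obtain Y where Y: "Y \<in> M"
    "\<forall>X\<in>M. X \<subseteq> Y \<longrightarrow> emeasure (K f) X \<le> emeasure (K g) X"
    "\<forall>X\<in>M. X \<inter> Y = {} \<longrightarrow> emeasure (K g) X \<le> emeasure (K f) X"
    unfolding sets by (elim bexE conjE) (rule that)
  show ?thesis
  proof (rule that)
    show "Y \<in> M" by (rule Y(1))
    show "f X \<le> g X" if "X \<in> M" "X \<subseteq> Y" for X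
      using Y(2)[rule_format, OF that] em[OF f that(1)] em[OF g that(1)] real_measure_nonneg[OF g that(1)]
      by (simp add: ennreal_le_iff)
    show "g X \<le> f X" if "X \<in> M" "X \<inter> Y = {}" for X
      using Y(3)[rule_format, OF that] em[OF f that(1)] em[OF g that(1)] real_measure_nonneg[OF f that(1)]
      by (simp add: ennreal_le_iff)
  qed
qed

end

section \<open>Conditional halving and Maharam's lemma\<close>

locale nowhere_equivalent_space = prob_space M for M :: "'t measure" +
  fixes \<F> :: "'t set set"
  assumes sigma_F: "sigma_algebra (space M) \<F>" and F_sets: "\<F> \<subseteq> sets M"
    and F_gen: "countably_generated (space M) \<F>"
    and F_ne: "nowhere_equivalent M \<F>"
begin

sublocale F: sigma_algebra "space M" \<F> by (rule sigma_F)

lemma F_measurable: "D \<in> \<F> \<Longrightarrow> D \<in> sets M"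
  using F_sets by blast

text \<open>A Hahn decomposition selects, locally on \<open>\<F>\<close>, the smaller of \<open>D0\<close> and \<open>E - D0\<close>; nowhere
  equivalence says that the result is not null.\<close>
lemma halving:
  assumes E: "E \<in> sets M" "0 < prob E"
  shows "\<exists>B\<in>sets M. B \<subseteq> E \<and> 0 < prob B \<and> (\<forall>D\<in>\<F>. prob (B \<inter> D) \<le> prob (E \<inter> D) / 2)"
proof -
  obtain D0 where D0: "D0 \<in> sets M" "D0 \<subseteq> E"
    "\<And>D'. D' \<in> \<F> \<Longrightarrow> 0 < prob (sym_diff D0 (E \<inter> D'))"
    using F_ne[unfolded nowhere_equivalent_def, rule_format, OF E] by (elim bexE conjE) (rule that, auto)
  have rm: "real_measure \<F> (\<lambda>D. prob (D0 \<inter> D))" "real_measure \<F> (\<lambda>D. prob ((E - D0) \<inter> D))"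
    using D0(1) E(1) by (auto intro!: real_measure_Int F_sets)
  obtain Y where Y: "Y \<in> \<F>" "\<And>X. X \<in> \<F> \<Longrightarrow> X \<subseteq> Y \<Longrightarrow> prob (D0 \<inter> X) \<le> prob ((E - D0) \<inter> X)"
    "\<And>X. X \<in> \<F> \<Longrightarrow> X \<inter> Y = {} \<Longrightarrow> prob ((E - D0) \<inter> X) \<le> prob (D0 \<inter> X)"
    by (rule F.real_measure_hahn[OF rm]) (rule that)
  define B where "B = (D0 \<inter> Y) \<union> ((E - D0) - Y)"
  have YM: "Y \<in> sets M" using Y(1) by (rule F_measurable)
  \<comment> \<open>As the symmetric difference of \<open>D0\<close> and a trace of an event of
    \<open>\<F>\<close>, \<open>B\<close> falls under nowhere equivalence and is not null.\<close>
  have "B = sym_diff D0 (E \<inter> (space M - Y))"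
    using D0(2) sets.sets_into_space[OF E(1)] by (auto simp: B_def)
  then have "0 < prob B" using D0(3)[of "space M - Y"] Y(1) by auto
  moreover have "prob (B \<inter> D) \<le> prob (E \<inter> D) / 2" if D: "D \<in> \<F>" for D
  proof -
    have DM: "D \<in> sets M" using D by (rule F_measurable)
    note [measurable] = DM YM D0(1) E(1)
    have sp: "D - Y \<in> \<F>" "D \<inter> Y \<in> \<F>" using D Y(1) by auto
    have "prob (B \<inter> D) = prob (D0 \<inter> (D \<inter> Y)) + prob ((E - D0) \<inter> (D - Y))"
      by (intro measure_split) (auto simp: B_def)
    moreover have "prob (E \<inter> D) = prob (D0 \<inter> (D \<inter> Y)) + prob ((E - D0) \<inter> (D \<inter> Y))
        + (prob (D0 \<inter> (D - Y)) + prob ((E - D0) \<inter> (D - Y)))"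
    proof -
      have "prob (E \<inter> D) = prob (E \<inter> (D \<inter> Y)) + prob (E \<inter> (D - Y))" by (intro measure_split) auto
      also have "prob (E \<inter> (D \<inter> Y)) = prob (D0 \<inter> (D \<inter> Y)) + prob ((E - D0) \<inter> (D \<inter> Y))"
        using D0(2) by (intro measure_split) auto
      also have "prob (E \<inter> (D - Y)) = prob (D0 \<inter> (D - Y)) + prob ((E - D0) \<inter> (D - Y))"
        using D0(2) by (intro measure_split) auto
      finally show ?thesis .
    qed
    moreover have "prob (D0 \<inter> (D \<inter> Y)) \<le> prob ((E - D0) \<inter> (D \<inter> Y))"
      "prob ((E - D0) \<inter> (D - Y)) \<le> prob (D0 \<inter> (D - Y))"
      using Y(2)[OF sp(2)] Y(3)[OF sp(1)] by auto
    ultimately show ?thesis by simp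
  qed
  moreover have "B \<in> sets M" "B \<subseteq> E" using YM D0 E by (auto simp: B_def)
  ultimately show ?thesis by blast
qed

text \<open>Each halving leaves a set of positive probability, so it can be repeated until the
  factor drops below \<open>c\<close>.\<close>

lemma small_subset:
  assumes E: "E \<in> sets M" "0 < prob E" and c: "0 < c"
  shows "\<exists>B\<in>sets M. B \<subseteq> E \<and> 0 < prob B \<and> (\<forall>D\<in>\<F>. prob (B \<inter> D) \<le> c * prob (E \<inter> D))"
proof -
  have "\<exists>B\<in>sets M. B \<subseteq> E \<and> 0 < prob B \<and> (\<forall>D\<in>\<F>. prob (B \<inter> D) \<le> (1/2) ^ n * prob (E \<inter> D))" for n
  proof (induction n)
    case 0
    then show ?case using E by auto
  next
    case (Suc n)
    then obtain B where B: "B \<in> sets M" "B \<subseteq> E" "0 < prob B"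
      "\<And>D. D \<in> \<F> \<Longrightarrow> prob (B \<inter> D) \<le> (1/2) ^ n * prob (E \<inter> D)" by blast
    obtain B' where B': "B' \<in> sets M" "B' \<subseteq> B" "0 < prob B'"
      "\<And>D. D \<in> \<F> \<Longrightarrow> prob (B' \<inter> D) \<le> prob (B \<inter> D) / 2" using halving[OF B(1,3)] by blast
    have "prob (B' \<inter> D) \<le> (1/2) ^ Suc n * prob (E \<inter> D)" if "D \<in> \<F>" for D
      using B(4)[OF that] B'(4)[OF that] by simp
    then show ?case using B B' by blast
  qed
  note step = this
  obtain n where n: "(1/2) ^ n < c" using real_arch_pow_inv[OF c, of "1/2"] by auto
  obtain B where B: "B \<in> sets M" "B \<subseteq> E" "0 < prob B"
    "\<And>D. D \<in> \<F> \<Longrightarrow> prob (B \<inter> D) \<le> (1/2) ^ n * prob (E \<inter> D)" using step[of n] by blast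
  have "prob (B \<inter> D) \<le> c * prob (E \<inter> D)" if "D \<in> \<F>" for D
    using order_trans[OF B(4)[OF that] mult_right_mono[of "(1/2)^n" c]] n by simp
  then show ?thesis using B by blast
qed

text \<open>Maharam's lemma: a maximal \<open>B\<close> with conditional mass at most \<open>\<mu>\<close> attains \<open>\<mu>\<close>.\<close>
lemma maharam:
  assumes \<mu>: "real_measure \<F> \<mu>" and E: "E \<in> sets M" and le: "\<And>D. D \<in> \<F> \<Longrightarrow> \<mu> D \<le> prob (E \<inter> D)"
  shows "\<exists>B\<in>sets M. B \<subseteq> E \<and> (\<forall>D\<in>\<F>. prob (B \<inter> D) = \<mu> D)"
proof -
  define V where "V = {B \<in> sets M. B \<subseteq> E \<and> (\<forall>D\<in>\<F>. prob (B \<inter> D) \<le> \<mu> D)}"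
  \<comment> \<open>Greedy exhaustion: each stage comes within \<open>1 / Suc n\<close> of the best
    that any extension in \<open>V\<close> can achieve, so no extension in \<open>V\<close> of the
    union of the stages has greater probability.\<close>
  have "\<exists>B'. B' \<in> V \<and> B \<subseteq> B' \<and> (\<forall>A\<in>V. B \<subseteq> A \<longrightarrow> prob A < prob B' + 1 / Suc n)" if B: "B \<in> V" for B n
  proof -
    define s where "s = Sup (prob ` {A \<in> V. B \<subseteq> A})"
    have bdd: "bdd_above (prob ` {A \<in> V. B \<subseteq> A})" by (intro bdd_aboveI2[where M = 1]) simp
    have "s - 1 / Suc n < s" by simp
    then obtain B' where B': "B' \<in> V" "B \<subseteq> B'" "s - 1 / Suc n < prob B'"
      unfolding s_def using less_cSup_iff[OF _ bdd] B by blast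
    have "prob A < prob B' + 1 / Suc n" if "A \<in> V" "B \<subseteq> A" for A
    proof -
      have "prob A \<le> s" unfolding s_def using that by (intro cSup_upper bdd) auto
      then show ?thesis using B'(3) by linarith
    qed
    then show ?thesis using B' by blast
  qed
  moreover have "{} \<in> V" using real_measure_nonneg[OF \<mu>] by (auto simp: V_def)
  ultimately have "\<exists>S. \<forall>n. S n \<in> V \<and> (S n \<subseteq> S (Suc n) \<and>
      (\<forall>A\<in>V. S n \<subseteq> A \<longrightarrow> prob A < prob (S (Suc n)) + 1 / Suc n))"
    by (intro dependent_nat_choice) auto
  then obtain S where S: "\<And>n. S n \<in> V" "\<And>n. S n \<subseteq> S (Suc n)"
    "\<And>n A. A \<in> V \<Longrightarrow> S n \<subseteq> A \<Longrightarrow> prob A < prob (S (Suc n)) + 1 / Suc n"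
    by blast
  have inc: "incseq S" using S(2) by (rule incseq_SucI)
  have SM: "S n \<in> sets M" for n using S(1)[of n] by (simp add: V_def)
  define B where "B = (\<Union>n. S n)"
  have BM: "B \<in> sets M" unfolding B_def using SM by auto
  have BE: "B \<subseteq> E" using S(1) by (auto simp: B_def V_def)
  have lB: "prob (B \<inter> D) \<le> \<mu> D" if D: "D \<in> \<F>" for D
  proof (rule LIMSEQ_le_const2)
    have "(\<lambda>n. prob (S n \<inter> D)) \<longlonglongrightarrow> prob (\<Union>n. S n \<inter> D)"
      using inc SM F_measurable[OF D] by (intro finite_Lim_measure_incseq) (auto simp: incseq_def)
    then show "(\<lambda>n. prob (S n \<inter> D)) \<longlonglongrightarrow> prob (B \<inter> D)" by (simp add: B_def)
    show "\<exists>N. \<forall>n\<ge>N. prob (S n \<inter> D) \<le> \<mu> D" using S(1) D by (auto simp: V_def)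
  qed
  have max: "prob A \<le> prob B" if A: "A \<in> V" "B \<subseteq> A" for A
  proof (rule field_le_epsilon)
    fix e :: real assume "0 < e"
    then obtain n where n: "1 / real (Suc n) < e" by (rule nat_approx_posE)
    have "S n \<subseteq> A" using A(2) by (auto simp: B_def)
    from S(3)[OF A(1) this] have "prob A < prob (S (Suc n)) + 1 / Suc n" .
    moreover have "prob (S (Suc n)) \<le> prob B" using BM by (intro finite_measure_mono) (auto simp: B_def)
    ultimately show "prob A \<le> prob B + e" using n by linarith
  qed
  have "prob (B \<inter> space M) = \<mu> (space M)"
  proof (rule ccontr)
    assume "prob (B \<inter> space M) \<noteq> \<mu> (space M)"
    then have gap: "prob (B \<inter> space M) < \<mu> (space M)" using lB[OF F.top] by simp
    \<comment> \<open>Half of the gap: at most \<open>c\<close> of the missing mass lies on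
      \<open>Y\<close>, so at least the other half is missing on \<open>Z\<close>.\<close>
    define c where "c = (\<mu> (space M) - prob (B \<inter> space M)) / 2"
    have c: "0 < c" using gap by (simp add: c_def)
    have "real_measure \<F> (\<lambda>D. prob (B \<inter> D) + c * prob (space M \<inter> D))"
      using c BM by (intro real_measure_add real_measure_cmult real_measure_Int F_sets) auto
    then obtain Y where Y: "Y \<in> \<F>"
      "\<And>X. X \<in> \<F> \<Longrightarrow> X \<subseteq> Y \<Longrightarrow> \<mu> X \<le> prob (B \<inter> X) + c * prob (space M \<inter> X)"
      "\<And>X. X \<in> \<F> \<Longrightarrow> X \<inter> Y = {} \<Longrightarrow> prob (B \<inter> X) + c * prob (space M \<inter> X) \<le> \<mu> X"
      by (rule F.real_measure_hahn[OF \<mu>]) (rule that)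
    define Z where "Z = space M - Y"
    have Z: "Z \<in> \<F>" "Z \<inter> Y = {}" "Z \<union> Y = space M"
      using Y(1) F.sets_into_space[OF Y(1)] by (auto simp: Z_def)
    note ZM = F_measurable[OF Z(1)] note YM = F_measurable[OF Y(1)]
    have "c * prob (space M \<inter> Y) \<le> c * 1" using c by (intro mult_left_mono) auto
    then have "\<mu> Y \<le> prob (B \<inter> Y) + c" using Y(2)[OF Y(1)] by simp
    moreover have "\<mu> (space M) = \<mu> Z + \<mu> Y"
      using F.real_measure_Un[OF \<mu> Z(1) Y(1) Z(2)] Z(3) by simp
    moreover have "prob (B \<inter> space M) = prob (B \<inter> Z) + prob (B \<inter> Y)"
      using BM ZM YM Z(2) by (intro measure_split) (auto simp: Z(3)[symmetric] Int_Un_distrib)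
    ultimately have "prob (B \<inter> Z) < \<mu> Z" using c by (simp add: c_def field_simps)
    also have "\<mu> Z \<le> prob (E \<inter> Z)" by (rule le[OF Z(1)])
    also have "prob (E \<inter> Z) = prob (B \<inter> Z) + prob ((E - B) \<inter> Z)"
      using BM E ZM BE by (intro measure_split) auto
    finally have pos: "0 < prob ((E - B) \<inter> Z)" by simp
    have EBZ: "(E - B) \<inter> Z \<in> sets M" using BM E ZM by auto
    \<comment> \<open>On every part of \<open>Z\<close> from \<open>\<F>\<close>, \<open>B\<close>
      leaves room for conditional density \<open>c\<close>. A set of positive probability with
      conditional mass at most \<open>c\<close> can thus be added without leaving \<open>V\<close>,
      against maximality.\<close>
    obtain C where C: "C \<in> sets M" "C \<subseteq> (E - B) \<inter> Z" "0 < prob C"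
      "\<And>D. D \<in> \<F> \<Longrightarrow> prob (C \<inter> D) \<le> c * prob ((E - B) \<inter> Z \<inter> D)"
      using small_subset[OF EBZ pos c] by (elim bexE conjE) (rule that, auto)
    have "prob ((B \<union> C) \<inter> D) \<le> \<mu> D" if D: "D \<in> \<F>" for D
    proof -
      note DM = F_measurable[OF D]
      have DZ: "D \<inter> Z \<in> \<F>" "D - Z \<in> \<F>" using D Z(1) by auto
      have "prob ((B \<union> C) \<inter> D) = prob (B \<inter> D) + prob (C \<inter> D)"
        using C(1,2) BM DM by (intro measure_split) auto
      also have "prob (B \<inter> D) = prob (B \<inter> (D \<inter> Z)) + prob (B \<inter> (D - Z))"
        using BM DM ZM by (intro measure_split) auto
      also have "prob (C \<inter> D) \<le> c * prob ((E - B) \<inter> Z \<inter> D)" by (rule C(4)[OF D])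
      also have "\<dots> \<le> c * prob (space M \<inter> (D \<inter> Z))"
        using c DM ZM by (intro mult_left_mono finite_measure_mono) (auto dest: sets.sets_into_space)
      finally have "prob ((B \<union> C) \<inter> D) \<le> (prob (B \<inter> (D \<inter> Z)) + c * prob (space M \<inter> (D \<inter> Z))) + prob (B \<inter> (D - Z))"
        by simp
      also have "\<dots> \<le> \<mu> (D \<inter> Z) + \<mu> (D - Z)"
        using Z(2) by (intro add_mono Y(3)[OF DZ(1)] lB[OF DZ(2)]) auto
      also have "\<dots> = \<mu> ((D \<inter> Z) \<union> (D - Z))"
        by (rule F.real_measure_Un[OF \<mu> DZ, symmetric]) blast
      also have "(D \<inter> Z) \<union> (D - Z) = D" by blast
      finally show ?thesis .
    qed
    then have "B \<union> C \<in> V" using BM C(1,2) BE by (auto simp: V_def)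
    then have "prob (B \<union> C) \<le> prob B" by (rule max) simp
    moreover have "prob (B \<union> C) = prob B + prob C" using BM C(1,2) by (intro finite_measure_Union) auto
    ultimately show False using C(3) by simp
  qed
  note tot = this
  \<comment> \<open>The inequality holds on \<open>D\<close> and on its complement, so equality of
    the totals forces equality on both.\<close>
  have "prob (B \<inter> D) = \<mu> D" if D: "D \<in> \<F>" for D
  proof -
    have cD: "space M - D \<in> \<F>" using D by auto
    have u: "D \<inter> (space M - D) = {}" "D \<union> (space M - D) = space M"
      using F.sets_into_space[OF D] by auto
    have "\<mu> (space M) = \<mu> D + \<mu> (space M - D)"
      using F.real_measure_Un[OF \<mu> D cD u(1)] u(2) by simp
    moreover have "prob (B \<inter> space M) = prob (B \<inter> D) + prob (B \<inter> (space M - D))"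
      using BM F_measurable[OF D] F_measurable[OF cD] sets.sets_into_space[OF BM]
      by (intro measure_split) auto
    ultimately show ?thesis using tot lB[OF D] lB[OF cD] by linarith
  qed
  then show ?thesis using BM BE by blast
qed

end

section \<open>Realizing limits of conditional laws\<close>

text \<open>The head of the list is the last bit: \<open>b # s\<close> refines the cell of \<open>s\<close> by the set with
  index \<open>length s\<close>.\<close>
primrec cell :: "'a set \<Rightarrow> (nat \<Rightarrow> 'a set) \<Rightarrow> bool list \<Rightarrow> 'a set" where
  "cell \<Omega> A [] = \<Omega>"
| "cell \<Omega> A (b # s) = cell \<Omega> A s \<inter> (if b then A (length s) else \<Omega> - A (length s))"

lemma cell_subset: "cell \<Omega> A s \<subseteq> \<Omega>"
  by (induction s) auto

lemma sets_cell: "(\<And>j. A j \<in> sets M) \<Longrightarrow> cell (space M) A s \<in> sets M"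
  by (induction s) auto

lemma cell_exists: "x \<in> \<Omega> \<Longrightarrow> x \<in> cell \<Omega> A (rev (map (\<lambda>j. x \<in> A j) [0..<m]))"
  by (induction m) auto

lemma cell_inj: "length s = length s' \<Longrightarrow> x \<in> cell \<Omega> A s \<Longrightarrow> x \<in> cell \<Omega> A s' \<Longrightarrow> s = s'"
  by (induction s s' rule: list_induct2) (auto split: if_splits)

lemma UN_cells: "(\<Union>s\<in>{s. length s = m}. cell \<Omega> A s) = \<Omega>"
proof (intro equalityI subsetI)
  fix x assume "x \<in> \<Omega>"
  then have "x \<in> cell \<Omega> A (rev (map (\<lambda>j. x \<in> A j) [0..<m]))" by (rule cell_exists)
  then show "x \<in> (\<Union>s\<in>{s. length s = m}. cell \<Omega> A s)"
    by (intro UN_I[of "rev (map (\<lambda>j. x \<in> A j) [0..<m])"]) auto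
qed (use cell_subset[of \<Omega> A] in blast)

lemma finite_lists_of_length: "finite {s :: bool list. length s = m}"
  using finite_lists_length_eq[of "UNIV :: bool set" m] by simp

text \<open>Summing over the older bits recovers a single event, so convergence of cell masses
  passes to the individual events.\<close>

lemma (in finite_measure) measure_bit:
  assumes "\<And>j. A j \<in> sets M"
  shows "measure M (A m) = (\<Sum>s\<in>{s. length s = m}. measure M (cell (space M) A (True # s)))"
proof -
  have "A m = (\<Union>s\<in>{s. length s = m}. cell (space M) A s \<inter> A m)"
    using UN_cells[of "space M" A m] sets.sets_into_space[OF assms[of m]] by auto
  also have "measure M \<dots> = (\<Sum>s\<in>{s. length s = m}. measure M (cell (space M) A s \<inter> A m))"
    using assms by (intro finite_measure_finite_Union finite_lists_of_length)
      (auto simp: disjoint_family_on_def intro: sets_cell dest: cell_inj)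
  also have "\<dots> = (\<Sum>s\<in>{s. length s = m}. measure M (cell (space M) A (True # s)))"
    by (intro sum.cong) auto
  finally show ?thesis .
qed

context nowhere_equivalent_space
begin

text \<open>The hypotheses are the consistency relations of a binary tree of set functions.
  Maharam's lemma splits the event at each node into two with the prescribed masses, and
  \<open>C j\<close> collects the \<open>True\<close> branches at depth \<open>j\<close>.\<close>

lemma realize_cells:
  assumes \<mu>: "\<And>s. real_measure \<F> (\<mu> s)"
    and Nil: "\<And>D. D \<in> \<F> \<Longrightarrow> \<mu> [] D = prob D"
    and split: "\<And>s D. D \<in> \<F> \<Longrightarrow> \<mu> s D = \<mu> (True # s) D + \<mu> (False # s) D"
  shows "\<exists>C. (\<forall>j. C j \<in> sets M) \<and> (\<forall>s. \<forall>D\<in>\<F>. prob (cell (space M) C s \<inter> D) = \<mu> s D)"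
proof -
  \<comment> \<open>The event to be split is an argument of \<open>B\<close>, so that the recursion
    for \<open>G\<close> can pass on the event of the parent node.\<close>
  define B where "B s G = (SOME B. B \<in> sets M \<and> B \<subseteq> G \<and> (\<forall>D\<in>\<F>. prob (B \<inter> D) = \<mu> (True # s) D))" for s G
  define G where "G = rec_list (space M) (\<lambda>b s G. if b then B s G else G - B s G)"
  have G_Nil: "G [] = space M" and G_Cons: "\<And>b s. G (b # s) = (if b then B s (G s) else G s - B s (G s))"
    by (simp_all add: G_def)
  have B: "B s G \<in> sets M \<and> B s G \<subseteq> G \<and> (\<forall>D\<in>\<F>. prob (B s G \<inter> D) = \<mu> (True # s) D)"
    if G: "G \<in> sets M" "\<And>D. D \<in> \<F> \<Longrightarrow> prob (G \<inter> D) = \<mu> s D" for s G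
  proof -
    have "\<mu> (True # s) D \<le> prob (G \<inter> D)" if "D \<in> \<F>" for D
      using G(2)[OF that] split[OF that, of s] real_measure_nonneg[OF \<mu> that, of "False # s"] by simp
    from maharam[of "\<mu> (True # s)" G, OF \<mu> G(1) this]
    have "\<exists>B. B \<in> sets M \<and> B \<subseteq> G \<and> (\<forall>D\<in>\<F>. prob (B \<inter> D) = \<mu> (True # s) D)" by blast
    then show ?thesis unfolding B_def by (rule someI_ex)
  qed
  have G: "G s \<in> sets M \<and> (\<forall>D\<in>\<F>. prob (G s \<inter> D) = \<mu> s D)" for s
  proof (induction s)
    case Nil
    show ?case using assms(2) sets.Int_space_eq1[OF F_measurable] by (simp add: G_Nil)
  next
    case (Cons b s)
    note Bs = B[of "G s" s]
    have "prob ((G s - B s (G s)) \<inter> D) = \<mu> (False # s) D" if D: "D \<in> \<F>" for D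
    proof -
      have "prob (G s \<inter> D) = prob (B s (G s) \<inter> D) + prob ((G s - B s (G s)) \<inter> D)"
        using Bs Cons F_measurable[OF D] by (intro measure_split) auto
      then show ?thesis using split[OF D, of s] Bs Cons D by simp
    qed
    then show ?case using Bs Cons by (auto simp: G_Cons)
  qed
  have Bs: "B s (G s) \<in> sets M" "B s (G s) \<subseteq> G s" for s
    using B[of "G s" s] G by auto
  have Gdisj: "s = s'" if "length s = length s'" "x \<in> G s" "x \<in> G s'" for x s s'
    using that
  proof (induction s s' rule: list_induct2)
    case (Cons b s b' s')
    then have "s = s'" using Bs(2) by (auto simp: G_Cons split: if_splits)
    then show ?case using Cons by (auto simp: G_Cons split: if_splits)
  qed simp
  define C where "C j = (\<Union>s\<in>{s. length s = j}. B s (G s))" for j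
  \<comment> \<open>Events of distinct nodes at the same depth are disjoint, so inside
    \<open>G s\<close> only the piece belonging to \<open>s\<close> survives.\<close>
  have CG: "C (length s) \<inter> G s = B s (G s)" for s
    using Bs(2) Gdisj by (fastforce simp: C_def)
  have "cell (space M) C s = G s" for s
  proof (induction s)
    case (Cons b s)
    have "G s \<subseteq> space M" using G sets.sets_into_space by blast
    then show ?case using Cons CG[of s] by (auto simp: G_Cons)
  qed (simp add: G_Nil)
  moreover have "C j \<in> sets M" for j
    unfolding C_def using Bs(1) by (intro sets.finite_UN finite_lists_of_length) auto
  ultimately show ?thesis using G by (intro exI[of _ C]) auto
qed

text \<open>Closing a countable generator under finite intersections keeps it countable and makes it
  fit for induction over complements and disjoint unions. The factor \<open>space M\<close> takes
  care of the empty intersection.\<close>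

lemma F_generator:
  obtains G where "countable G" "G \<subseteq> Pow (space M)" "Int_stable G" "\<F> = sigma_sets (space M) G"
proof -
  obtain C where C: "countable C" "C \<subseteq> Pow (space M)" "\<F> = sigma_sets (space M) C"
    using F_gen unfolding countably_generated_def by (elim exE conjE) (rule that)
  define G where "G = (\<lambda>I. space M \<inter> \<Inter>I) ` {I. finite I \<and> I \<subseteq> C}"
  have "countable G" unfolding G_def by (intro countable_image countable_Collect_finite_subset C(1))
  moreover have "G \<subseteq> Pow (space M)" by (auto simp: G_def)
  moreover have "Int_stable G"
  proof (rule Int_stableI)
    fix a b assume "a \<in> G" "b \<in> G"
    then obtain I J where "finite I" "I \<subseteq> C" "finite J" "J \<subseteq> C" "a = space M \<inter> \<Inter>I" "b = space M \<inter> \<Inter>J"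
      by (auto simp: G_def)
    then show "a \<inter> b \<in> G" unfolding G_def by (intro image_eqI[where x = "I \<union> J"]) auto
  qed
  moreover have "\<F> = sigma_sets (space M) G"
  proof
    have "C \<subseteq> G"
    proof
      fix c assume "c \<in> C"
      then show "c \<in> G" using C(2) unfolding G_def by (intro image_eqI[where x = "{c}"]) auto
    qed
    then show "\<F> \<subseteq> sigma_sets (space M) G" unfolding C(3) by (rule sigma_sets_mono')
    have "space M \<inter> \<Inter>I \<in> \<F>" if "finite I" "I \<subseteq> C" for I
      using that
    proof (induction I rule: finite_induct)
      case (insert c I)
      then have "c \<in> \<F>" by (auto simp: C(3))
      moreover have "space M \<inter> \<Inter>I \<in> \<F>" using insert by blast
      ultimately have "c \<inter> (space M \<inter> \<Inter>I) \<in> \<F>" by (rule F.Int)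
      also have "c \<inter> (space M \<inter> \<Inter>I) = space M \<inter> \<Inter>(insert c I)" by blast
      finally show ?case .
    qed simp
    then have "G \<subseteq> \<F>" by (auto simp: G_def)
    then show "sigma_sets (space M) G \<subseteq> \<F>" by (rule F.sigma_sets_subset)
  qed
  ultimately show ?thesis by (rule that)
qed

end

text \<open>The random elements may live on \<open>N\<close> while their limit is sought on
  \<open>M\<close>. The two are compared only through masses of cells over events of
  \<open>\<F>\<close> and their preimages. Two instances occur: the identity of \<open>M\<close>,
  and the product of \<open>M\<close> with a coin.\<close>

locale measure_preserving_extension = nowhere_equivalent_space M \<F> + N: prob_space N
  for M :: "'t measure" and \<F> and N :: "'w measure" +
  fixes \<pi> :: "'w \<Rightarrow> 't"
  assumes \<pi>_measurable[measurable]: "\<pi> \<in> measurable N M" and distr_\<pi>: "distr N M \<pi> = M"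
begin

definition fib :: "'t set \<Rightarrow> 'w set" where "fib D = \<pi> -` D \<inter> space N"

lemma sets_fib: "D \<in> sets M \<Longrightarrow> fib D \<in> sets N"
  unfolding fib_def by measurable

lemma prob_fib: "D \<in> sets M \<Longrightarrow> N.prob (fib D) = prob D"
  using measure_distr[OF \<pi>_measurable, of D] by (simp add: distr_\<pi> fib_def)

text \<open>A diagonal subsequence settles countably many codes and generating events. The mass of a
  cell over \<open>D\<close> is at most \<open>prob D\<close>, uniformly in \<open>n\<close>, so
  Tannery's theorem exchanges limit and countable sum. This exchange both extends convergence to all
  of \<open>\<F>\<close> and proves the limits countably additive.\<close>

lemma cell_limits:
  fixes A :: "nat \<Rightarrow> nat \<Rightarrow> 'w set"
  assumes A: "\<And>n j. A n j \<in> sets N"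
  shows "\<exists>r \<mu>. strict_mono r \<and> (\<forall>s. real_measure \<F> (\<mu> s)) \<and>
    (\<forall>s. \<forall>D\<in>\<F>. (\<lambda>n. N.prob (cell (space N) (A (r n)) s \<inter> fib D)) \<longlonglongrightarrow> \<mu> s D)"
proof -
  define p where "p s D n = N.prob (cell (space N) (A n) s \<inter> fib D)" for s D n
  have cellN: "cell (space N) (A n) s \<in> sets N" for n s using A by (rule sets_cell)
  have p01: "0 \<le> p s D n" "p s D n \<le> 1" for s D n by (auto simp: p_def)
  have p_le: "p s D n \<le> prob D" if "D \<in> \<F>" for s D n
    unfolding p_def prob_fib[OF F_measurable[OF that], symmetric]
    by (intro N.finite_measure_mono sets_fib F_measurable that) auto
  obtain G where G: "countable G" "G \<subseteq> Pow (space M)" "Int_stable G" "\<F> = sigma_sets (space M) G"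
    by (rule F_generator)
  \<comment> \<open>The whole space is adjoined because convergence for a complement is obtained by
    subtraction from it.\<close>
  define I where "I = (UNIV :: bool list set) \<times> insert (space M) G"
  have I: "countable I" "I \<noteq> {}" using G(1) by (auto simp: I_def)
  define e where "e = from_nat_into I"
  define P where "P k r \<longleftrightarrow> convergent (\<lambda>n. p (fst (e k)) (snd (e k)) (r n))" for k and r :: "nat \<Rightarrow> nat"
  interpret subseqs P
  proof
    fix k and s :: "nat \<Rightarrow> nat"
    have "bounded (range (\<lambda>n. p (fst (e k)) (snd (e k)) (s n)))"
      using p01 by (intro boundedI[where B = 1]) auto
    from bounded_imp_convergent_subsequence[OF this]
    obtain l r where "strict_mono r" "((\<lambda>n. p (fst (e k)) (snd (e k)) (s n)) \<circ> r) \<longlonglongrightarrow> l" by blast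
    then show "\<exists>r'. strict_mono r' \<and> P k (s \<circ> r')"
      by (intro exI[of _ r]) (auto simp: P_def convergent_def o_def)
  qed
  define r where "r = diagseq"
  have r: "strict_mono r" unfolding r_def by (rule subseq_diagseq)
  \<comment> \<open>Only a tail of the diagonal sequence is a subsequence of the \<open>k\<close>-th
    one; convergence does not see the initial segment.\<close>
  have "P k (r \<circ> (+) (Suc k))" for k
    unfolding r_def
  proof (rule diagseq_holds)
    fix r s :: "nat \<Rightarrow> nat" and n assume "strict_mono r" "P n s"
    then show "P n (s \<circ> r)"
      unfolding P_def convergent_def
      using LIMSEQ_subseq_LIMSEQ[of "\<lambda>m. p (fst (e n)) (snd (e n)) (s m)" _ r] by (auto simp: o_def)
  qed
  note diag = this
  have conv_e: "convergent (\<lambda>n. p (fst (e k)) (snd (e k)) (r n))" for k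
  proof -
    have "convergent (\<lambda>n. p (fst (e k)) (snd (e k)) (r (n + Suc k)))"
      using diag[of k] by (simp only: P_def o_def add.commute[of "Suc k"])
    then show ?thesis
      by (rule convergent_ignore_initial_segment[of "\<lambda>n. p (fst (e k)) (snd (e k)) (r n)", THEN iffD1])
  qed
  have conv_I: "convergent (\<lambda>n. p s D (r n))" if "D \<in> insert (space M) G" for s D
  proof -
    have "(s, D) \<in> I" using that by (simp add: I_def)
    then obtain k where "e k = (s, D)" unfolding e_def using from_nat_into_surj[OF I(1)] by blast
    then show ?thesis using conv_e[of k] by simp
  qed
  have p_sums: "(\<lambda>k. p s (D k) n) sums p s (\<Union>k. D k) n"
    if D: "range D \<subseteq> \<F>" "disjoint_family D" for s n and D :: "nat \<Rightarrow> 't set"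
  proof -
    have "cell (space N) (A n) s \<inter> fib (D k) \<in> sets N" for k
      using D(1) cellN by (intro sets.Int sets_fib F_measurable) auto
    then have "(\<lambda>k. N.prob (cell (space N) (A n) s \<inter> fib (D k))) sums
        N.prob (\<Union>k. cell (space N) (A n) s \<inter> fib (D k))"
      using D(2) by (intro N.finite_measure_UNION) (auto simp: disjoint_family_on_def fib_def)
    moreover have "(\<Union>k. cell (space N) (A n) s \<inter> fib (D k)) = cell (space N) (A n) s \<inter> fib (\<Union>k. D k)"
      by (auto simp: fib_def)
    ultimately show ?thesis by (simp add: p_def)
  qed
  have tannery: "summable (\<lambda>k. b k) \<and> (\<lambda>n. p s (\<Union>k. D k) (r n)) \<longlonglongrightarrow> suminf b"
    if D: "range D \<subseteq> \<F>" "disjoint_family D" and b: "\<And>k. (\<lambda>n. p s (D k) (r n)) \<longlonglongrightarrow> b k"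
    for s and b :: "nat \<Rightarrow> real" and D :: "nat \<Rightarrow> 't set"
  proof -
    have DM: "range D \<subseteq> sets M" using D(1) F_sets by blast
    have "eventually (\<lambda>(k, n). norm (p s (D k) (r n)) \<le> prob (D k)) (at_top \<times>\<^sub>F sequentially)"
      using D(1) p_le p01 by (intro always_eventually) auto
    moreover have "summable (\<lambda>k. prob (D k))"
      using finite_measure_UNION[OF DM D(2)] by (rule sums_summable)
    ultimately have "summable (\<lambda>k. norm (b k)) \<and>
        (\<lambda>n. \<Sum>k. p s (D k) (r n)) \<longlonglongrightarrow> suminf b"
      using tannerys_theorem[of "\<lambda>k n. p s (D k) (r n)" b sequentially "\<lambda>k. prob (D k)"] b by simp
    moreover have "(\<Sum>k. p s (D k) (r n)) = p s (\<Union>k. D k) (r n)" for n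
      using p_sums[OF D] by (rule sums_unique[symmetric])
    ultimately show ?thesis using summable_rabs_cancel[of b] by auto
  qed
  have conv: "convergent (\<lambda>n. p s D (r n))" if D: "D \<in> \<F>" for s D
    using G(3) G(2) D[unfolded G(4)]
  proof (induction rule: sigma_sets_induct_disjoint)
    case (basic A)
    then show ?case by (intro conv_I) simp
  next
    case empty
    show ?case by (simp add: p_def fib_def convergent_const)
  next
    case (compl D)
    then have DF: "D \<in> \<F>" by (simp add: G(4))
    have "p s (space M - D) n = p s (space M) n - p s D n" for n
    proof -
      have "p s (space M) n = p s D n + p s (space M - D) n"
        unfolding p_def using cellN sets_fib[OF F_measurable[OF DF]] sets_fib[OF F_measurable[OF F.compl_sets[OF DF]]]
          F.sets_into_space[OF DF]
        by (intro N.measure_split) (auto simp: fib_def)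
      then show ?thesis by simp
    qed
    then show ?case using compl conv_I[of "space M" s] by (auto intro!: convergent_diff)
  next
    case (union D)
    then have b: "(\<lambda>n. p s (D k) (r n)) \<longlonglongrightarrow> lim (\<lambda>n. p s (D k) (r n))" for k
      by (simp add: convergent_LIMSEQ_iff)
    have "range D \<subseteq> \<F>" using union by (simp add: G(4))
    from tannery[OF this union(1) b] show ?case by (auto simp: convergent_def)
  qed
  define \<mu> where "\<mu> s D = lim (\<lambda>n. p s D (r n))" for s D
  have lim: "(\<lambda>n. p s D (r n)) \<longlonglongrightarrow> \<mu> s D" if "D \<in> \<F>" for s D
    using conv[OF that] unfolding \<mu>_def by (simp add: convergent_LIMSEQ_iff)
  have "real_measure \<F> (\<mu> s)" for s
  proof (rule real_measureI)
    fix D assume "D \<in> \<F>"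
    from lim[OF this] show "0 \<le> \<mu> s D" by (rule LIMSEQ_le_const) (use p01 in blast)
  next
    fix D :: "nat \<Rightarrow> 't set" assume D: "range D \<subseteq> \<F>" "disjoint_family D"
    have "(\<lambda>n. p s (D k) (r n)) \<longlonglongrightarrow> \<mu> s (D k)" for k using D(1) by (intro lim) auto
    from tannery[OF D this] have *: "summable (\<lambda>k. \<mu> s (D k))"
      "(\<lambda>n. p s (\<Union>k. D k) (r n)) \<longlonglongrightarrow> (\<Sum>k. \<mu> s (D k))" by auto
    have "(\<Union>k. D k) \<in> \<F>" using D(1) by auto
    from LIMSEQ_unique[OF *(2) lim[OF this]] *(1)
    show "(\<lambda>k. \<mu> s (D k)) sums \<mu> s (\<Union>k. D k)" by (metis summable_sums)
  qed
  with r lim show ?thesis unfolding p_def by blast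
qed

text \<open>The total mass at the root and additivity under splitting are preserved by limits, so
  the limit masses form a consistent tree and are realized by events of \<open>M\<close>.\<close>

lemma realize_limits:
  fixes A :: "nat \<Rightarrow> nat \<Rightarrow> 'w set"
  assumes A: "\<And>n j. A n j \<in> sets N"
  obtains r C where "strict_mono r" "\<And>j. C j \<in> sets M"
    "\<And>s D. D \<in> \<F> \<Longrightarrow> (\<lambda>n. N.prob (cell (space N) (A (r n)) s \<inter> fib D)) \<longlonglongrightarrow> prob (cell (space M) C s \<inter> D)"
    "\<And>j. (\<lambda>n. N.prob (A (r n) j)) \<longlonglongrightarrow> prob (C j)"
proof -
  obtain r \<mu> where r: "strict_mono r" and \<mu>: "\<And>s. real_measure \<F> (\<mu> s)" and
    lim: "\<And>s D. D \<in> \<F> \<Longrightarrow> (\<lambda>n. N.prob (cell (space N) (A (r n)) s \<inter> fib D)) \<longlonglongrightarrow> \<mu> s D"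
    using cell_limits[of A, OF A] by (elim exE conjE) (rule that, auto)
  have cellN: "cell (space N) (A n) s \<in> sets N" for n s using A by (rule sets_cell)
  have nil: "\<mu> [] D = prob D" if D: "D \<in> \<F>" for D
  proof (rule LIMSEQ_unique[OF lim[OF D]])
    have "space N \<inter> fib D = fib D" by (auto simp: fib_def)
    then show "(\<lambda>n. N.prob (cell (space N) (A (r n)) [] \<inter> fib D)) \<longlonglongrightarrow> prob D"
      by (simp add: prob_fib F_measurable D)
  qed
  have split: "\<mu> s D = \<mu> (True # s) D + \<mu> (False # s) D" if D: "D \<in> \<F>" for s D
  proof (rule LIMSEQ_unique[OF lim[OF D]])
    have "N.prob (cell (space N) (A n) s \<inter> fib D) = N.prob (cell (space N) (A n) (True # s) \<inter> fib D)
        + N.prob (cell (space N) (A n) (False # s) \<inter> fib D)" for n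
      using cellN sets_fib[OF F_measurable[OF D]] A cell_subset[of "space N" "A n" s]
      by (intro N.measure_split) (auto simp del: cell.simps, auto)
    then show "(\<lambda>n. N.prob (cell (space N) (A (r n)) s \<inter> fib D)) \<longlonglongrightarrow> \<mu> (True # s) D + \<mu> (False # s) D"
      by (simp only:) (intro tendsto_add lim D)
  qed
  have "\<exists>C. (\<forall>j. C j \<in> sets M) \<and> (\<forall>s. \<forall>D\<in>\<F>. prob (cell (space M) C s \<inter> D) = \<mu> s D)"
    by (rule realize_cells) (fact \<mu> nil split)+
  then obtain C where C': "\<forall>j. C j \<in> sets M"
    "\<forall>s. \<forall>D\<in>\<F>. prob (cell (space M) C s \<inter> D) = \<mu> s D"
    by (elim exE conjE) (rule that)
  note C = C'(1)[rule_format] C'(2)[rule_format]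
  have lim': "(\<lambda>n. N.prob (cell (space N) (A (r n)) s \<inter> fib D)) \<longlonglongrightarrow> prob (cell (space M) C s \<inter> D)"
    if "D \<in> \<F>" for s D using lim[OF that] C(2)[OF that] by simp
  have full: "(\<lambda>n. N.prob (cell (space N) (A (r n)) s)) \<longlonglongrightarrow> prob (cell (space M) C s)" for s
  proof -
    have "cell (space N) (A (r n)) s \<inter> fib (space M) = cell (space N) (A (r n)) s" for n
      using cell_subset[of "space N" "A (r n)" s] measurable_space[OF \<pi>_measurable] by (auto simp: fib_def)
    moreover have "cell (space M) C s \<inter> space M = cell (space M) C s" using cell_subset[of "space M" C s] by blast
    ultimately show ?thesis using lim'[OF F.top, of s] by simp
  qed
  have "(\<lambda>n. N.prob (A (r n) j)) \<longlonglongrightarrow> prob (C j)" for j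
    unfolding measure_bit[of C, OF C(1)] N.measure_bit[of "A (r _)", OF A]
    by (intro tendsto_sum full)
  from that[OF r C(1) lim' this] show ?thesis .
qed

end

section \<open>Limits of selections\<close>

lemma norming_bounded_linear: "norming \<phi> \<Longrightarrow> bounded_linear (\<phi> k)"
  and norming_le: "norming \<phi> \<Longrightarrow> \<phi> k x \<le> norm x"
  and norming_approx: "norming \<phi> \<Longrightarrow> 0 < e \<Longrightarrow> \<exists>k. norm x - e < \<phi> k x"
  by (simp_all add: norming_def)

lemma norming_abs_le:
  assumes "norming \<phi>" shows "\<bar>\<phi> k x\<bar> \<le> norm x"
proof -
  interpret bounded_linear "\<phi> k" using assms by (rule norming_bounded_linear)
  show ?thesis using norming_le[OF assms, of k x] norming_le[OF assms, of k "- x"] neg[of x] by simp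
qed

text \<open>A closed ball about the origin is a countable intersection of half-spaces; hence it is
  weakly closed, and membership in it is decided by countably many coordinates.\<close>

lemma norming_norm_le_iff:
  assumes "norming \<phi>" shows "norm x \<le> a \<longleftrightarrow> (\<forall>k. \<phi> k x \<le> a)"
proof
  assume r: "\<forall>k. \<phi> k x \<le> a"
  show "norm x \<le> a"
  proof (rule field_le_epsilon)
    fix e :: real assume "0 < e"
    then obtain k where "norm x - e < \<phi> k x" using norming_approx[OF assms, of e x] by blast
    then show "norm x \<le> a + e" using spec[OF r, of k] by simp
  qed
qed (use norming_le[OF assms] order_trans in blast)

lemma norming_eqI:
  assumes "norming \<phi>" "\<And>k. \<phi> k x = \<phi> k y" shows "x = y"
proof -
  have "\<phi> k (x - y) = 0" for k
    using linear_simps(2)[OF norming_bounded_linear[OF assms(1)], of k x y] assms(2)[of k] by simp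
  then have "norm (x - y) \<le> 0" by (simp add: norming_norm_le_iff[OF assms(1)])
  then show ?thesis by simp
qed

lemma norming_Cons:
  assumes "norming \<phi>" "bounded_linear \<psi>" "\<And>x. \<psi> x \<le> norm x"
  shows "norming (case_nat \<psi> \<phi>)"
  unfolding norming_def
proof (intro conjI allI impI)
  fix x :: 'a and e :: real assume "0 < e"
  then obtain k where "norm x - e < \<phi> k x" using norming_approx[OF assms(1), of e x] by blast
  then show "\<exists>k. norm x - e < case_nat \<psi> \<phi> k x" by (intro exI[of _ "Suc k"]) simp
qed (use assms in \<open>auto simp: norming_def split: nat.split\<close>)

text \<open>By the Lindelof property an open set is a countable union of balls.\<close>

lemma borel_measurable_ballsI:
  fixes f :: "'t \<Rightarrow> 'x::{metric_space, second_countable_topology}"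
  assumes "\<And>c. (\<lambda>t. dist c (f t)) \<in> borel_measurable M"
  shows "f \<in> borel_measurable M"
proof (rule borel_measurableI)
  fix S :: "'x set" assume S: "open S"
  define B where "B = {b. (\<exists>x e. b = ball x e) \<and> b \<subseteq> S}"
  obtain B' where B': "B' \<subseteq> B" "countable B'" "\<Union>B' = \<Union>B"
  proof (rule Lindelof[of B])
    show "open b" if "b \<in> B" for b using that by (auto simp: B_def)
  qed
  have "\<Union>B = S"
  proof
    show "S \<subseteq> \<Union>B"
    proof
      fix x assume "x \<in> S"
      then obtain e where "0 < e" "ball x e \<subseteq> S" using S by (meson open_contains_ball)
      then show "x \<in> \<Union>B" by (intro UnionI[of "ball x e"]) (auto simp: B_def)
    qed
  qed (auto simp: B_def)
  then have "S = \<Union>B'" by (simp add: B'(3))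
  then have "f -` S \<inter> space M = (\<Union>b\<in>B'. f -` b \<inter> space M)" by blast
  also have "\<dots> \<in> sets M"
  proof (rule sets.countable_UN'[OF B'(2)], clarify)
    fix b assume "b \<in> B'"
    then obtain c e where "b = ball c e" using B'(1) by (auto simp: B_def)
    then have "f -` b \<inter> space M = {t \<in> space M. dist c (f t) < e}" by auto
    also have "\<dots> \<in> sets M" using assms[of c] by measurable
    finally show "f -` b \<inter> space M \<in> sets M" .
  qed
  finally show "f -` S \<inter> space M \<in> sets M" .
qed

text \<open>In the spirit of Pettis: distances to fixed points are suprema of countably many
  coordinates, so measurable coordinates suffice in a separable space.\<close>

lemma borel_measurable_norming:
  fixes f :: "'t \<Rightarrow> 'x::{real_normed_vector, second_countable_topology}"
  assumes \<phi>: "norming \<phi>" and f: "\<And>k. (\<lambda>t. \<phi> k (f t)) \<in> borel_measurable M"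
  shows "f \<in> borel_measurable M"
proof (rule borel_measurable_ballsI)
  fix c
  show "(\<lambda>t. dist c (f t)) \<in> borel_measurable M"
    unfolding borel_measurable_iff_le
  proof
    fix a
    have "{t \<in> space M. dist c (f t) \<le> a} = {t \<in> space M. \<forall>k. \<phi> k (f t) \<le> a + \<phi> k c}"
      using linear_simps(2)[OF norming_bounded_linear[OF \<phi>]]
      by (simp add: dist_norm norm_minus_commute[of c] norming_norm_le_iff[OF \<phi>] diff_le_eq)
    also have "\<dots> \<in> sets M" using f by measurable
    finally show "{t \<in> space M. dist c (f t) \<le> a} \<in> sets M" .
  qed
qed

text \<open>\<open>P j\<close> and \<open>Q j\<close> are weakly closed enlargements of
  \<open>A j\<close> and its complement, because membership in \<open>A j\<close> itself need not
  survive limits. Almost every \<open>t\<close> lies, at each depth, in a cell whose enlargement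
  meets \<open>F0 t\<close>; weak compactness then yields one point compatible with all bits of
  \<open>t\<close>.\<close>

lemma (in measure_preserving_extension) limit_selection_bits:
  fixes f :: "nat \<Rightarrow> 'w \<Rightarrow> 'x::{real_normed_vector, second_countable_topology}"
  assumes f[measurable]: "\<And>n. f n \<in> borel_measurable N"
    and sel: "\<And>n. AE w in N. f n w \<in> Fn n (\<pi> w)"
    and Fn: "\<And>n. measurable_correspondence (space M) \<F> (Fn n)"
    and F0: "measurable_correspondence (space M) \<F> F0"
    and wc: "AE t in M. compactin weak_topology (F0 t)"
    and upper: "\<And>t V. t \<in> space M \<Longrightarrow> openin weak_topology V \<Longrightarrow> F0 t \<subseteq> V \<Longrightarrow>
      \<forall>\<^sub>F n in sequentially. Fn n t \<subseteq> V"
    and A: "\<And>j :: nat. A j \<in> sets borel"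
    and P: "\<And>j. closedin weak_topology (P j)" "\<And>j. A j \<subseteq> P j"
    and Q: "\<And>j. closedin weak_topology (Q j)" "\<And>j. - A j \<subseteq> Q j"
  obtains r C where "strict_mono r" "\<And>j. C j \<in> sets M"
    "AE t in M. \<exists>x\<in>F0 t. \<forall>j. (t \<in> C j \<longrightarrow> x \<in> P j) \<and> (t \<notin> C j \<longrightarrow> x \<in> Q j)"
    "\<And>j. (\<lambda>n. N.prob {w \<in> space N. f (r n) w \<in> A j}) \<longlonglongrightarrow> prob (C j)"
proof -
  define A' :: "nat \<Rightarrow> nat \<Rightarrow> 'w set" where "A' n j = {w \<in> space N. f n w \<in> A j}" for n j
  have A': "A' n j \<in> sets N" for n j unfolding A'_def using A[of j] f[of n] by measurable
  obtain r C where r: "strict_mono r" and C: "\<And>j. C j \<in> sets M" and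
    lim: "\<And>s D. D \<in> \<F> \<Longrightarrow> (\<lambda>n. N.prob (cell (space N) (A' (r n)) s \<inter> fib D)) \<longlonglongrightarrow> prob (cell (space M) C s \<inter> D)"
    and lim1: "\<And>j. (\<lambda>n. N.prob (A' (r n) j)) \<longlonglongrightarrow> prob (C j)"
    by (rule realize_limits[of A', OF A']) (rule that)
  define E where "E = rec_list UNIV (\<lambda>b s G. G \<inter> (if b then P (length s) else Q (length s)))"
  have E_Nil: "E [] = UNIV" and E_Cons: "\<And>b s. E (b # s) = E s \<inter> (if b then P (length s) else Q (length s))"
    by (simp_all add: E_def)
  have E_closed: "closedin weak_topology (E s)" for s
  proof (induction s)
    case Nil
    show ?case using closedin_topspace[of "weak_topology :: 'x topology"] by (simp add: E_Nil)
  qed (auto simp: E_Cons P Q)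
  have cell_E: "f n w \<in> E s" if "w \<in> cell (space N) (A' n) s" for n w s
    using that
  proof (induction s)
    case (Cons b s)
    then show ?case using P(2)[of "length s"] Q(2)[of "length s"]
      by (cases b) (auto simp: E_Cons A'_def)
  qed (simp add: E_Nil)
  \<comment> \<open>\<open>S s\<close> collects the \<open>t\<close> for which \<open>F0 t\<close>
    misses the enlarged cell. It belongs to \<open>\<F>\<close> since weakly closed sets are norm
    closed, so convergence of the masses may be tested on it.\<close>
  define S where "S s = space M - {t \<in> space M. F0 t \<inter> E s \<noteq> {}}" for s
  have S: "S s \<in> \<F>" for s
    using F0 closedin_weak_imp_closed[OF E_closed] unfolding S_def measurable_correspondence_def by auto
  have null: "prob (cell (space M) C s \<inter> S s) = 0" for s
  proof -
    \<comment> \<open>On \<open>R n\<close> the value of \<open>Fn n\<close> still meets an enlarged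
      cell that \<open>F0\<close> misses. By \<open>upper\<close> each \<open>t\<close> lies in
      finitely many \<open>R n\<close>, so their probabilities tend to 0, and with them the mass of
      the cell over \<open>S s\<close>.\<close>
    define R where "R n = S s \<inter> {t \<in> space M. Fn n t \<inter> E s \<noteq> {}}" for n
    have R: "R n \<in> sets M" for n
      using Fn[of n] closedin_weak_imp_closed[OF E_closed, of s] S[of s]
      unfolding R_def measurable_correspondence_def by (intro sets.Int F_measurable) auto
    have "(\<lambda>n. \<integral>t. indicat_real (R n) t \<partial>M) \<longlonglongrightarrow> (\<integral>t. 0 \<partial>M)"
    proof (rule integral_dominated_convergence[where w = "\<lambda>_. 1"])
      show "AE t in M. (\<lambda>n. indicat_real (R n) t) \<longlonglongrightarrow> 0"
      proof (rule AE_I2)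
        fix t assume t: "t \<in> space M"
        show "(\<lambda>n. indicat_real (R n) t) \<longlonglongrightarrow> 0"
        proof (cases "t \<in> S s")
          case True
          then have "F0 t \<subseteq> - E s" by (auto simp: S_def)
          moreover have "openin weak_topology (- E s)"
            using E_closed[of s] by (simp add: closedin_def Compl_eq_Diff_UNIV)
          ultimately have "\<forall>\<^sub>F n in sequentially. Fn n t \<subseteq> - E s" by (intro upper t)
          then have "\<forall>\<^sub>F n in sequentially. indicat_real (R n) t = 0"
            by (rule eventually_mono) (auto simp: R_def indicator_def)
          then show ?thesis by (rule tendsto_eventually)
        qed (simp add: R_def)
      qed
    qed (use R in auto)
    then have "(\<lambda>n. prob (R n)) \<longlonglongrightarrow> 0" using R by simp
    then have Rlim: "(\<lambda>n. prob (R (r n))) \<longlonglongrightarrow> 0"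
      using LIMSEQ_subseq_LIMSEQ[OF _ r] by (auto simp: o_def)
    have "N.prob (cell (space N) (A' (r n)) s \<inter> fib (S s)) \<le> prob (R (r n))" for n
    proof -
      have "AE w in N. w \<in> cell (space N) (A' (r n)) s \<inter> fib (S s) \<longrightarrow> w \<in> fib (R (r n))"
        using sel[of "r n"]
      proof eventually_elim
        case (elim w)
        then show ?case using cell_E[of w "r n" s] measurable_space[OF \<pi>_measurable, of w]
          by (auto simp: fib_def R_def)
      qed
      then have "N.prob (cell (space N) (A' (r n)) s \<inter> fib (S s)) \<le> N.prob (fib (R (r n)))"
        by (rule N.finite_measure_mono_AE) (rule sets_fib[OF R])
      also have "\<dots> = prob (R (r n))" by (rule prob_fib[OF R])
      finally show ?thesis .
    qed
    then have "prob (cell (space M) C s \<inter> S s) \<le> 0"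
      using LIMSEQ_le[OF lim[OF S] Rlim] by blast
    then show ?thesis using measure_nonneg[of M "cell (space M) C s \<inter> S s"] by linarith
  qed
  have "AE t in M. \<forall>s. t \<notin> cell (space M) C s \<inter> S s"
    unfolding AE_all_countable
  proof
    fix s
    have "cell (space M) C s \<inter> S s \<in> sets M" using S F_measurable C by (intro sets.Int sets_cell) auto
    then have "cell (space M) C s \<inter> S s \<in> null_sets M"
      using null[of s] by (auto simp: emeasure_eq_measure)
    then show "AE t in M. t \<notin> cell (space M) C s \<inter> S s" by (rule AE_not_in)
  qed
  then have "AE t in M. \<exists>x\<in>F0 t. \<forall>j. (t \<in> C j \<longrightarrow> x \<in> P j) \<and> (t \<notin> C j \<longrightarrow> x \<in> Q j)"
    using wc AE_space
  proof eventually_elim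
    case (elim t)
    define s where "s m = rev (map (\<lambda>j. t \<in> C j) [0..<m])" for m
    have s_Suc: "s (Suc m) = (t \<in> C m) # s m" and s_len: "length (s m) = m" for m by (simp_all add: s_def)
    have "F0 t \<inter> E (s m) \<noteq> {}" for m
    proof -
      have "t \<in> cell (space M) C (s m)" unfolding s_def using elim(3) by (rule cell_exists)
      then have "t \<notin> S (s m)" using elim(1) by blast
      then show ?thesis using elim(3) by (auto simp: S_def)
    qed
    moreover have "decseq (\<lambda>m. E (s m))" by (rule decseq_SucI) (auto simp: s_Suc E_Cons)
    ultimately obtain x where x: "x \<in> F0 t" "\<And>m. x \<in> E (s m)"
      using weakly_compact_nested[OF elim(2), of "\<lambda>m. E (s m)"] E_closed by blast
    have "(t \<in> C j \<longrightarrow> x \<in> P j) \<and> (t \<notin> C j \<longrightarrow> x \<in> Q j)" for j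
      using x(2)[of "Suc j"] by (auto simp: s_Suc E_Cons s_len)
    then show ?case using x(1) by blast
  qed
  from that[OF r C this] show ?thesis using lim1 by (simp add: A'_def)
qed

text \<open>Strict inequalities for \<open>X n\<close> leave only weak ones for \<open>Y\<close>.
  They give \<open>F y \<le> prob (C q) \<le> F (of_rat q)\<close> for \<open>y < of_rat q\<close>,
  and the slack disappears at continuity points of the distribution function.\<close>

lemma (in prob_space) weak_conv_m_bitsI:
  fixes X :: "nat \<Rightarrow> 'b \<Rightarrow> real" and Y :: "'a \<Rightarrow> real"
  assumes N: "prob_space N" and X[measurable]: "\<And>n. X n \<in> borel_measurable N"
    and Y[measurable]: "Y \<in> borel_measurable M"
    and bits: "\<And>q :: rat. \<exists>C\<in>sets M. (\<lambda>n. measure N {w \<in> space N. X n w < of_rat q}) \<longlonglongrightarrow> prob C \<and>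
      (AE t in M. (t \<in> C \<longrightarrow> Y t \<le> of_rat q) \<and> (t \<notin> C \<longrightarrow> of_rat q \<le> Y t))"
  shows "weak_conv_m (\<lambda>n. distr N borel (X n)) (distr M borel Y)"
  unfolding weak_conv_m_def weak_conv_def
proof (intro allI impI)
  interpret N: prob_space N by (rule N)
  define F where "F = cdf (distr M borel Y)"
  fix x assume "isCont (cdf (distr M borel Y)) x"
  then have cont: "isCont F x" by (simp add: F_def)
  have cX: "cdf (distr N borel (X n)) x = N.prob {w \<in> space N. X n w \<le> x}" for n
    by (simp add: cdf_def measure_distr vimage_def Int_def conj_commute)
  have cY: "F y = prob {t \<in> space M. Y t \<le> y}" for y
    by (simp add: F_def cdf_def measure_distr vimage_def Int_def conj_commute)
  have "\<forall>q :: rat. \<exists>C. C \<in> sets M \<and> (\<lambda>n. N.prob {w \<in> space N. X n w < of_rat q}) \<longlonglongrightarrow> prob C \<and>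
      (AE t in M. (t \<in> C \<longrightarrow> Y t \<le> of_rat q) \<and> (t \<notin> C \<longrightarrow> of_rat q \<le> Y t))"
    using bits by (simp only: Bex_def) simp
  from choice[OF this] obtain C :: "rat \<Rightarrow> 'a set" where C: "\<And>q. C q \<in> sets M"
    "\<And>q. (\<lambda>n. N.prob {w \<in> space N. X n w < of_rat q}) \<longlonglongrightarrow> prob (C q)"
    "\<And>q. AE t in M. t \<in> C q \<longrightarrow> Y t \<le> of_rat q" "\<And>q. AE t in M. t \<notin> C q \<longrightarrow> of_rat q \<le> Y t"
    unfolding AE_conj_iff all_conj_distrib by (elim exE conjE) (rule that; erule spec)
  have up: "prob (C q) \<le> F (of_rat q)" for q
    unfolding cY using C(1)[of q] C(3)[of q] AE_space
    by (intro finite_measure_mono_AE) (auto elim: eventually_elim2)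
  have lo: "F y \<le> prob (C q)" if "y < of_rat q" for q y
    unfolding cY using C(1)[of q] C(4)[of q] that
    by (intro finite_measure_mono_AE) (auto elim!: eventually_mono)
  show "(\<lambda>n. cdf (distr N borel (X n)) x) \<longlonglongrightarrow> cdf (distr M borel Y) x"
    unfolding F_def[symmetric] cX
  proof (rule order_tendstoI)
    fix a assume "F x < a"
    then have "\<forall>\<^sub>F y in at x. F y < a" using cont by (intro order_tendstoD) (simp_all add: isCont_def)
    then obtain d where d: "0 < d" "\<And>y. y \<noteq> x \<Longrightarrow> dist y x < d \<Longrightarrow> F y < a"
      unfolding eventually_at by auto
    obtain q where q: "x < of_rat q" "of_rat q < x + d"
      using of_rat_dense[of x "x + d"] d(1) by auto
    have "prob (C q) < a" using up[of q] d(2)[of "of_rat q"] q by (simp add: dist_real_def)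
    then have "\<forall>\<^sub>F n in sequentially. N.prob {w \<in> space N. X n w < of_rat q} < a"
      using C(2) by (rule order_tendstoD(2)[rotated])
    then show "\<forall>\<^sub>F n in sequentially. N.prob {w \<in> space N. X n w \<le> x} < a"
    proof (rule eventually_mono)
      fix n assume "N.prob {w \<in> space N. X n w < of_rat q} < a"
      moreover have "N.prob {w \<in> space N. X n w \<le> x} \<le> N.prob {w \<in> space N. X n w < of_rat q}"
        using q(1) by (intro N.finite_measure_mono) auto
      ultimately show "N.prob {w \<in> space N. X n w \<le> x} < a" by linarith
    qed
  next
    fix a assume "a < F x"
    then have "\<forall>\<^sub>F y in at x. a < F y" using cont by (intro order_tendstoD) (simp_all add: isCont_def)
    then obtain d where d: "0 < d" "\<And>y. y \<noteq> x \<Longrightarrow> dist y x < d \<Longrightarrow> a < F y"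
      unfolding eventually_at by auto
    obtain q where q: "x - d / 2 < of_rat q" "of_rat q < x"
      using of_rat_dense[of "x - d / 2" x] d(1) by auto
    have "a < F (x - d / 2)" using d by (simp add: dist_real_def)
    also have "\<dots> \<le> prob (C q)" by (rule lo[OF q(1)])
    finally have "\<forall>\<^sub>F n in sequentially. a < N.prob {w \<in> space N. X n w < of_rat q}"
      using C(2) by (rule order_tendstoD(1)[rotated])
    then show "\<forall>\<^sub>F n in sequentially. a < N.prob {w \<in> space N. X n w \<le> x}"
    proof (rule eventually_mono)
      fix n assume "a < N.prob {w \<in> space N. X n w < of_rat q}"
      moreover have "N.prob {w \<in> space N. X n w < of_rat q} \<le> N.prob {w \<in> space N. X n w \<le> x}"
        using q(2) by (intro N.finite_measure_mono) auto
      ultimately show "a < N.prob {w \<in> space N. X n w \<le> x}" by linarith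
    qed
  qed
qed

section \<open>From convergence in distribution to convergence of integrals\<close>

lemma (in prob_space) integral_trunc_error:
  fixes X g :: "'a \<Rightarrow> real"
  assumes X[measurable]: "X \<in> borel_measurable M" and g: "integrable M g" and le: "AE t in M. \<bar>X t\<bar> \<le> g t"
    and K: "0 \<le> K"
  shows "\<bar>(\<integral>t. X t \<partial>M) - (\<integral>t. max (- K) (min (X t) K) \<partial>M)\<bar> \<le> (\<integral>t. max 0 (g t - K) \<partial>M)"
proof -
  have [measurable]: "g \<in> borel_measurable M" using g by simp
  have iX: "integrable M X" by (rule Bochner_Integration.integrable_bound[OF g X]) (use le in auto)
  have iT: "integrable M (\<lambda>t. max (- K) (min (X t) K))"
    by (rule integrable_const_bound[where B = K]) (use K in auto)
  have iG: "integrable M (\<lambda>t. max 0 (g t - K))"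
    by (rule Bochner_Integration.integrable_bound[OF g]) (use K in auto)
  have "\<bar>(\<integral>t. X t \<partial>M) - (\<integral>t. max (- K) (min (X t) K) \<partial>M)\<bar> = \<bar>\<integral>t. X t - max (- K) (min (X t) K) \<partial>M\<bar>"
    using iX iT by simp
  also have "\<dots> \<le> (\<integral>t. \<bar>X t - max (- K) (min (X t) K)\<bar> \<partial>M)" by (rule integral_abs_bound)
  also have "\<dots> \<le> (\<integral>t. max 0 (g t - K) \<partial>M)"
    using iX iT iG le by (intro integral_mono_AE) (auto elim!: eventually_mono)
  finally show ?thesis .
qed

lemma (in prob_space) integral_tail_tendsto_0:
  fixes g :: "'a \<Rightarrow> real"
  assumes g: "integrable M g"
  shows "(\<lambda>K. \<integral>t. max 0 (g t - real K) \<partial>M) \<longlonglongrightarrow> 0"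
proof -
  have [measurable]: "g \<in> borel_measurable M" using g by simp
  have "(\<lambda>K. \<integral>t. max 0 (g t - real K) \<partial>M) \<longlonglongrightarrow> (\<integral>t. 0 \<partial>M)"
  proof (rule integral_dominated_convergence[where w = "\<lambda>t. \<bar>g t\<bar>"])
    show "AE t in M. (\<lambda>K. max 0 (g t - real K)) \<longlonglongrightarrow> 0"
    proof (rule AE_I2)
      fix t
      obtain m where "g t < real m" using reals_Archimedean2 by blast
      then have "\<forall>\<^sub>F K in sequentially. max 0 (g t - real K) = 0"
        unfolding eventually_sequentially by (intro exI[of _ m]) auto
      then show "(\<lambda>K. max 0 (g t - real K)) \<longlonglongrightarrow> 0" by (rule tendsto_eventually)
    qed
  qed (use g in auto)
  then show ?thesis by simp
qed

text \<open>Truncation at \<open>K\<close> is bounded and continuous, so weak convergence applies to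
  it. A single bound \<open>g\<close> for all \<open>X n\<close> makes the truncation error uniform
  in \<open>n\<close>. The three thirds of \<open>e\<close> are the truncation errors on
  \<open>N\<close> and on \<open>M\<close> and the difference of the truncated integrals.\<close>

lemma (in prob_space) weak_conv_m_integral:
  fixes X :: "nat \<Rightarrow> 'b \<Rightarrow> real" and Y :: "'a \<Rightarrow> real"
  assumes N: "prob_space N" and X[measurable]: "\<And>n. X n \<in> borel_measurable N"
    and Y[measurable]: "Y \<in> borel_measurable M"
    and wc: "weak_conv_m (\<lambda>n. distr N borel (X n)) (distr M borel Y)"
    and g: "integrable N g" "\<And>n. AE w in N. \<bar>X n w\<bar> \<le> g w"
    and h: "integrable M h" "AE t in M. \<bar>Y t\<bar> \<le> h t"
  shows "(\<lambda>n. \<integral>w. X n w \<partial>N) \<longlonglongrightarrow> (\<integral>t. Y t \<partial>M)"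
proof (rule LIMSEQ_I)
  interpret N: prob_space N by (rule N)
  fix e :: real assume e: "0 < e"
  have "\<forall>\<^sub>F K in sequentially. (\<integral>w. max 0 (g w - real K) \<partial>N) < e / 3 \<and> (\<integral>t. max 0 (h t - real K) \<partial>M) < e / 3"
    using e by (intro eventually_conj order_tendstoD(2)[OF N.integral_tail_tendsto_0[OF g(1)]]
      order_tendstoD(2)[OF integral_tail_tendsto_0[OF h(1)]]) auto
  then obtain K :: nat where K: "(\<integral>w. max 0 (g w - real K) \<partial>N) < e / 3" "(\<integral>t. max 0 (h t - real K) \<partial>M) < e / 3"
    using eventually_happens'[OF sequentially_bot] by blast
  define T where "T x = max (- real K) (min x (real K))" for x
  have T[measurable]: "T \<in> borel_measurable borel" unfolding T_def by measurable
  have "(\<lambda>n. integral\<^sup>L (distr N borel (X n)) T) \<longlonglongrightarrow> integral\<^sup>L (distr M borel Y) T"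
  proof (rule weak_conv_imp_integral_bdd_continuous_conv[OF _ _ wc, where B = "real K"])
    show "real_distribution (distr N borel (X n))" for n by (rule N.real_distribution_distr) simp
    show "real_distribution (distr M borel Y)" by (rule real_distribution_distr) simp
    show "isCont T x" for x unfolding T_def by (intro continuous_intros)
    show "norm (T x) \<le> real K" for x by (auto simp: T_def)
  qed
  then have "(\<lambda>n. \<integral>w. T (X n w) \<partial>N) \<longlonglongrightarrow> (\<integral>t. T (Y t) \<partial>M)" by (simp add: integral_distr)
  then obtain n0 where n0: "\<And>n. n \<ge> n0 \<Longrightarrow> \<bar>(\<integral>w. T (X n w) \<partial>N) - (\<integral>t. T (Y t) \<partial>M)\<bar> < e / 3"
    using LIMSEQ_D[of _ _ "e / 3"] e by fastforce
  have "norm ((\<integral>w. X n w \<partial>N) - (\<integral>t. Y t \<partial>M)) < e" if "n \<ge> n0" for n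
    using n0[OF that] K N.integral_trunc_error[OF X g(1) g(2), of "real K" n]
      integral_trunc_error[OF Y h, of "real K"] unfolding T_def real_norm_def by linarith
  then show "\<exists>no. \<forall>n\<ge>no. norm ((\<integral>w. X n w \<partial>N) - (\<integral>t. Y t \<partial>M)) < e" by blast
qed

text \<open>A sum type interleaves two families of bits. Rational half-spaces control the
  distribution of each \<open>\<phi> k\<close>; integer balls compare the tails of the norms, which
  the coordinates taken one by one do not control.\<close>

lemma (in measure_preserving_extension) limit_selection:
  fixes f :: "nat \<Rightarrow> 'w \<Rightarrow> 'x::{real_normed_vector, second_countable_topology}"
  assumes f[measurable]: "\<And>n. f n \<in> borel_measurable N"
    and sel: "\<And>n. AE w in N. f n w \<in> Fn n (\<pi> w)"
    and Fn: "\<And>n. measurable_correspondence (space M) \<F> (Fn n)"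
    and F0: "measurable_correspondence (space M) \<F> F0"
    and wc: "AE t in M. compactin weak_topology (F0 t)"
    and upper: "\<And>t V. t \<in> space M \<Longrightarrow> openin weak_topology V \<Longrightarrow> F0 t \<subseteq> V \<Longrightarrow>
      \<forall>\<^sub>F n in sequentially. Fn n t \<subseteq> V"
    and \<phi>: "norming \<phi>"
  obtains r h where "strict_mono r" "h \<in> borel_measurable M" "AE t in M. h t \<in> F0 t"
    "\<And>k. weak_conv_m (\<lambda>n. distr N borel (\<lambda>w. \<phi> k (f (r n) w))) (distr M borel (\<lambda>t. \<phi> k (h t)))"
    "\<And>i :: nat. \<exists>c. (\<lambda>n. N.prob {w \<in> space N. norm (f (r n) w) \<le> real i}) \<longlonglongrightarrow> c \<and>
        c \<le> prob {t \<in> space M. norm (h t) \<le> real i}"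
proof -
  note bl = norming_bounded_linear[OF \<phi>]
  have [measurable]: "\<phi> k \<in> borel_measurable borel" for k
    using linear_continuous_on[OF bl] by (rule borel_measurable_continuous_onI)
  \<comment> \<open>Only one side of a norm bit is weakly closed, so the other side carries no constraint; one side
    suffices to control the integrability of the limit.\<close>
  define A P Q :: "nat \<Rightarrow> 'x set" where
    "A j = (case from_nat j :: (nat \<times> rat) + nat of Inl (k, q) \<Rightarrow> {x. \<phi> k x < of_rat q} | Inr i \<Rightarrow> {x. norm x \<le> real i})" and
    "P j = (case from_nat j :: (nat \<times> rat) + nat of Inl (k, q) \<Rightarrow> {x. \<phi> k x \<le> of_rat q} | Inr i \<Rightarrow> {x. norm x \<le> real i})" and
    "Q j = (case from_nat j :: (nat \<times> rat) + nat of Inl (k, q) \<Rightarrow> {x. of_rat q \<le> \<phi> k x} | Inr i \<Rightarrow> UNIV)"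
    for j :: nat
  have le_closed: "closedin weak_topology {x. \<phi> k x \<le> a}" for k a
    using closedin_weak_vimage[OF bl closed_atMost] by (simp add: vimage_def)
  have ge_closed: "closedin weak_topology {x. a \<le> \<phi> k x}" for k a
    using closedin_weak_vimage[OF bl closed_atLeast] by (simp add: vimage_def)
  have norm_closed: "closedin weak_topology {x :: 'x. norm x \<le> a}" for a
  proof -
    have "{x :: 'x. norm x \<le> a} = (\<Inter>k. {x. \<phi> k x \<le> a})" by (auto simp: norming_norm_le_iff[OF \<phi>])
    then show ?thesis using le_closed by auto
  qed
  have "closedin weak_topology (UNIV :: 'x set)"
    using closedin_topspace[of "weak_topology :: 'x topology"] by simp
  note closed = le_closed ge_closed norm_closed this
  have A: "A j \<in> sets borel" for j
    by (cases "from_nat j :: (nat \<times> rat) + nat") (auto simp: A_def split: prod.split)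
  have P: "closedin weak_topology (P j)" for j
    by (simp add: P_def closed split: sum.split prod.split)
  have Q: "closedin weak_topology (Q j)" for j
    by (simp add: Q_def closed split: sum.split prod.split)
  have AP: "A j \<subseteq> P j" for j
    by (cases "from_nat j :: (nat \<times> rat) + nat") (auto simp: A_def P_def)
  have AQ: "- A j \<subseteq> Q j" for j
    by (cases "from_nat j :: (nat \<times> rat) + nat") (auto simp: A_def Q_def)
  obtain r C where r: "strict_mono r" and C: "\<And>j. C j \<in> sets M" and
    ex: "AE t in M. \<exists>x\<in>F0 t. \<forall>j. (t \<in> C j \<longrightarrow> x \<in> P j) \<and> (t \<notin> C j \<longrightarrow> x \<in> Q j)" and
    lim: "\<And>j. (\<lambda>n. N.prob {w \<in> space N. f (r n) w \<in> A j}) \<longlonglongrightarrow> prob (C j)"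
    by (rule limit_selection_bits[of f Fn F0 A P Q, OF f sel Fn F0 wc upper A P AP Q AQ]) (assumption | rule that)+
  obtain Z where Z: "Z \<in> null_sets M"
    "{t \<in> space M. \<not> (\<exists>x\<in>F0 t. \<forall>j. (t \<in> C j \<longrightarrow> x \<in> P j) \<and> (t \<notin> C j \<longrightarrow> x \<in> Q j))} \<subseteq> Z"
    using ex by (auto simp: eventually_ae_filter)
  \<comment> \<open>An arbitrary choice is measurable here because the bits determine every
    \<open>\<phi> k (h t)\<close>: it is squeezed between the rationals \<open>q\<close> with
    \<open>t\<close> outside \<open>D k q\<close> and those with \<open>t\<close> inside. On the
    null set \<open>Z\<close> the value is 0, whence the case distinction on
    \<open>0 < a\<close>.\<close>
  define h where "h t = (if t \<in> Z then 0 else SOME x. x \<in> F0 t \<and> (\<forall>j. (t \<in> C j \<longrightarrow> x \<in> P j) \<and> (t \<notin> C j \<longrightarrow> x \<in> Q j)))" for t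
  have h: "h t \<in> F0 t \<and> (\<forall>j. (t \<in> C j \<longrightarrow> h t \<in> P j) \<and> (t \<notin> C j \<longrightarrow> h t \<in> Q j))" if "t \<in> space M" "t \<notin> Z" for t
  proof -
    have "\<exists>x. x \<in> F0 t \<and> (\<forall>j. (t \<in> C j \<longrightarrow> x \<in> P j) \<and> (t \<notin> C j \<longrightarrow> x \<in> Q j))"
      using that Z(2) by blast
    from someI_ex[OF this] show ?thesis using that(2) by (simp add: h_def)
  qed
  define D where "D k q = C (to_nat (Inl (k, q) :: (nat \<times> rat) + nat))" for k q
  have D: "D k q \<in> sets M" for k q by (simp add: D_def C)
  have D_lo: "\<phi> k (h t) \<le> of_rat q" if "t \<in> space M" "t \<notin> Z" "t \<in> D k q" for t k q
    using h[OF that(1,2)] that(3) by (auto simp: D_def P_def dest!: spec[of _ "to_nat (Inl (k, q) :: (nat \<times> rat) + nat)"])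
  have D_hi: "of_rat q \<le> \<phi> k (h t)" if "t \<in> space M" "t \<notin> Z" "t \<notin> D k q" for t k q
    using h[OF that(1,2)] that(3) by (auto simp: D_def Q_def dest!: spec[of _ "to_nat (Inl (k, q) :: (nat \<times> rat) + nat)"])
  have Zs: "Z \<in> sets M" using Z(1) by auto
  have \<phi>0: "\<phi> k 0 = 0" for k using linear_simps(3)[OF bl] .
  have "(\<lambda>t. \<phi> k (h t)) \<in> borel_measurable M" for k
    unfolding borel_measurable_iff_less
  proof
    fix a
    have "{t \<in> space M. \<phi> k (h t) < a} =
      (if 0 < a then Z else {}) \<union> ((\<Union>q\<in>{q. of_rat q < a}. D k q) - Z)"
    proof (intro equalityI subsetI)
      fix t assume t: "t \<in> {t \<in> space M. \<phi> k (h t) < a}"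
      show "t \<in> (if 0 < a then Z else {}) \<union> ((\<Union>q\<in>{q. of_rat q < a}. D k q) - Z)"
      proof (cases "t \<in> Z")
        case True
        then show ?thesis using t by (auto simp: h_def \<phi>0)
      next
        case False
        obtain q where q: "\<phi> k (h t) < of_rat q" "of_rat q < a" using of_rat_dense[of "\<phi> k (h t)" a] t by auto
        then have "t \<in> D k q" using D_hi[of t k q] t False by force
        then show ?thesis using q False by auto
      qed
    next
      fix t assume t: "t \<in> (if 0 < a then Z else {}) \<union> ((\<Union>q\<in>{q. of_rat q < a}. D k q) - Z)"
      then have sp: "t \<in> space M" 
        using subsetD[OF sets.sets_into_space[OF D]] subsetD[OF sets.sets_into_space[OF Zs]]
        by (auto split: if_splits)
      show "t \<in> {t \<in> space M. \<phi> k (h t) < a}"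
      proof (cases "t \<in> Z")
        case True
        then show ?thesis using t sp by (auto simp: h_def \<phi>0 split: if_splits)
      next
        case False
        then obtain q where "of_rat q < a" "t \<in> D k q" using t by (auto split: if_splits)
        then show ?thesis using D_lo[OF sp False, of k q] sp by auto
      qed
    qed
    also have "\<dots> \<in> sets M" using Zs D by (intro sets.Un sets.Diff sets.countable_UN') auto
    finally show "{t \<in> space M. \<phi> k (h t) < a} \<in> sets M" .
  qed
  then have hm[measurable]: "h \<in> borel_measurable M" by (rule borel_measurable_norming[OF \<phi>])
  have nZ: "AE t in M. t \<notin> Z" using Z(1) by (rule AE_not_in)
  have hF: "AE t in M. h t \<in> F0 t" using nZ AE_space by eventually_elim (use h in blast)
  have wcm: "weak_conv_m (\<lambda>n. distr N borel (\<lambda>w. \<phi> k (f (r n) w))) (distr M borel (\<lambda>t. \<phi> k (h t)))" for k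
  proof (rule weak_conv_m_bitsI)
    fix q :: rat
    have "(\<lambda>n. N.prob {w \<in> space N. \<phi> k (f (r n) w) < of_rat q}) \<longlonglongrightarrow> prob (D k q)"
      using lim[of "to_nat (Inl (k, q) :: (nat \<times> rat) + nat)"] by (simp add: A_def D_def)
    moreover have "AE t in M. (t \<in> D k q \<longrightarrow> \<phi> k (h t) \<le> of_rat q) \<and> (t \<notin> D k q \<longrightarrow> of_rat q \<le> \<phi> k (h t))"
      using nZ AE_space by eventually_elim (use D_lo D_hi in blast)
    ultimately show "\<exists>C\<in>sets M. (\<lambda>n. measure N {w \<in> space N. \<phi> k (f (r n) w) < of_rat q}) \<longlonglongrightarrow> prob C \<and>
        (AE t in M. (t \<in> C \<longrightarrow> \<phi> k (h t) \<le> of_rat q) \<and> (t \<notin> C \<longrightarrow> of_rat q \<le> \<phi> k (h t)))"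
      using D by blast
  qed (rule N.prob_space_axioms, measurable)
  have "\<exists>c. (\<lambda>n. N.prob {w \<in> space N. norm (f (r n) w) \<le> real i}) \<longlonglongrightarrow> c \<and>
        c \<le> prob {t \<in> space M. norm (h t) \<le> real i}" for i :: nat
  proof (intro exI conjI)
    let ?j = "to_nat (Inr i :: (nat \<times> rat) + nat)"
    show "(\<lambda>n. N.prob {w \<in> space N. norm (f (r n) w) \<le> real i}) \<longlonglongrightarrow> prob (C ?j)"
      using lim[of ?j] by (simp add: A_def)
    have "AE t in M. t \<in> C ?j \<longrightarrow> norm (h t) \<le> real i"
      using nZ AE_space
    proof eventually_elim
      case (elim t)
      then show ?case using h[of t] by (auto simp: P_def dest!: spec[of _ ?j])
    qed
    then show "prob (C ?j) \<le> prob {t \<in> space M. norm (h t) \<le> real i}"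
      using AE_space by (intro finite_measure_mono_AE) (auto elim: eventually_elim2)
  qed
  from that[OF r hm hF wcm this] show ?thesis .
qed

section \<open>The integral of a correspondence\<close>

text \<open>The tails at the integers sum to the integral of the ceiling, which exceeds the variable
  by at most one; comparing tails at integers therefore decides integrability.\<close>

lemma integrable_of_tail_bound:
  fixes X :: "'b \<Rightarrow> real" and Y :: "'a \<Rightarrow> real"
  assumes "prob_space N" "prob_space M" and X: "integrable N X" "\<And>w. 0 \<le> X w"
    and Y[measurable]: "Y \<in> borel_measurable M" and Y0: "\<And>t. 0 \<le> Y t"
    and le: "\<And>i :: nat. measure N {w \<in> space N. X w \<le> real i} \<le> measure M {t \<in> space M. Y t \<le> real i}"
  shows "integrable M Y"
proof -
  interpret N: prob_space N by fact
  interpret M: prob_space M by fact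
  have [measurable]: "X \<in> borel_measurable N" using X(1) by simp
  have less: "i < nat \<lceil>z\<rceil> \<longleftrightarrow> real i < z" for i z
    by (metis less_ceiling_iff of_int_of_nat_eq zless_nat_conj nat_less_iff zless_nat_eq_int_zless)
  have tail: "emeasure M {t \<in> space M. i < nat \<lceil>Y t\<rceil>} \<le> emeasure N {w \<in> space N. i < nat \<lceil>X w\<rceil>}" for i
  proof -
    have "{t \<in> space M. i < nat \<lceil>Y t\<rceil>} = space M - {t \<in> space M. Y t \<le> real i}"
      "{w \<in> space N. i < nat \<lceil>X w\<rceil>} = space N - {w \<in> space N. X w \<le> real i}"
      by (auto simp: less)
    then show ?thesis using le[of i]
      by (simp add: M.emeasure_eq_measure N.emeasure_eq_measure M.prob_compl N.prob_compl)
  qed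
  have "(\<integral>\<^sup>+t. ennreal (Y t) \<partial>M) \<le> (\<integral>\<^sup>+t. of_nat (nat \<lceil>Y t\<rceil>) \<partial>M)"
  proof (rule nn_integral_mono)
    fix t
    have "Y t \<le> real (nat \<lceil>Y t\<rceil>)" by (rule real_nat_ceiling_ge)
    then show "ennreal (Y t) \<le> of_nat (nat \<lceil>Y t\<rceil>)" by (simp add: ennreal_of_nat_eq_real_of_nat ennreal_leI)
  qed
  also have "\<dots> = (\<Sum>i. emeasure M {t \<in> space M. i < nat \<lceil>Y t\<rceil>})" by (rule nn_integral_nat_function) measurable
  also have "\<dots> \<le> (\<Sum>i. emeasure N {w \<in> space N. i < nat \<lceil>X w\<rceil>})" by (intro suminf_le tail) auto
  also have "\<dots> = (\<integral>\<^sup>+w. of_nat (nat \<lceil>X w\<rceil>) \<partial>N)" by (rule nn_integral_nat_function[symmetric]) measurable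
  also have "\<dots> \<le> (\<integral>\<^sup>+w. ennreal (X w + 1) \<partial>N)"
  proof (rule nn_integral_mono)
    fix w
    have "real (nat \<lceil>X w\<rceil>) \<le> X w + 1" using X(2)[of w] by linarith
    then show "of_nat (nat \<lceil>X w\<rceil>) \<le> ennreal (X w + 1)" by (simp add: ennreal_of_nat_eq_real_of_nat ennreal_leI)
  qed
  also have "\<dots> = ennreal (\<integral>w. X w + 1 \<partial>N)"
    using X by (intro nn_integral_eq_integral) auto
  also have "\<dots> < \<infinity>" by simp
  finally show ?thesis using Y0 by (intro integrableI_bounded) auto
qed

lemma integrable_selection_bound:
  fixes f :: "'t \<Rightarrow> 'x::{banach, second_countable_topology}"
  assumes "f \<in> borel_measurable M" "AE t in M. f t \<in> F t" "integrable M g"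
    "AE t in M. \<forall>x\<in>F t. norm x \<le> g t"
  shows "integrable M f"
proof (rule Bochner_Integration.integrable_bound[OF assms(3,1)])
  show "AE t in M. norm (f t) \<le> norm (g t)"
    using assms(2,4) by eventually_elim force
qed

lemma integral_correspondenceI:
  "integrable M f \<Longrightarrow> AE t in M. f t \<in> F t \<Longrightarrow> integral\<^sup>L M f \<in> integral_correspondence M F"
  by (auto simp: integral_correspondence_def selection_def)

lemma integral_correspondenceE:
  assumes "x \<in> integral_correspondence M F"
  obtains f where "integrable M f" "AE t in M. f t \<in> F t" "x = integral\<^sup>L M f"
  using assms by (auto simp: integral_correspondence_def selection_def)

context nowhere_equivalent_space
begin

lemma measure_preserving_extension_id: "measure_preserving_extension M \<F> M (\<lambda>t. t)"
proof -
  have "distr M M (\<lambda>t. t) = M" by (rule distr_id)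
  then show ?thesis
    by (intro measure_preserving_extension.intro nowhere_equivalent_space_axioms prob_space_axioms
        measure_preserving_extension_axioms.intro) auto
qed

text \<open>The identity serves as the extension. The common bound \<open>g\<close> carries
  convergence in distribution of each coordinate over to its integral, and bounded functionals
  commute with the Bochner integral.\<close>

lemma integral_limit_norming:
  fixes f :: "nat \<Rightarrow> 't \<Rightarrow> 'x::{banach, second_countable_topology}"
  assumes f: "\<And>n. integrable M (f n)" and sel: "\<And>n. AE t in M. f n t \<in> Fn n t"
    and Fn: "\<And>n. measurable_correspondence (space M) \<F> (Fn n)"
    and F0: "measurable_correspondence (space M) \<F> F0"
    and wc: "AE t in M. compactin weak_topology (F0 t)"
    and upper: "\<forall>t\<in>space M. \<forall>V. openin weak_topology V \<longrightarrow> F0 t \<subseteq> V \<longrightarrow>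
      (\<forall>\<^sub>F n in sequentially. Fn n t \<subseteq> V)"
    and g: "integrable M g" "\<And>n. AE t in M. norm (f n t) \<le> g t" "AE t in M. \<forall>x\<in>F0 t. norm x \<le> g t"
    and \<phi>: "norming \<phi>"
  shows "\<exists>r h. strict_mono r \<and> integrable M h \<and> (AE t in M. h t \<in> F0 t) \<and>
    (\<forall>k. (\<lambda>n. \<phi> k (\<integral>t. f (r n) t \<partial>M)) \<longlonglongrightarrow> \<phi> k (\<integral>t. h t \<partial>M))"
proof -
  interpret E: measure_preserving_extension M \<F> M "\<lambda>t. t" by (rule measure_preserving_extension_id)
  have fm: "f n \<in> borel_measurable M" for n using f[of n] by simp
  obtain r h where r: "strict_mono r" and h: "h \<in> borel_measurable M" "AE t in M. h t \<in> F0 t"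
    and wcm: "\<And>k. weak_conv_m (\<lambda>n. distr M borel (\<lambda>t. \<phi> k (f (r n) t))) (distr M borel (\<lambda>t. \<phi> k (h t)))"
    by (rule E.limit_selection[of f Fn F0 \<phi>, OF fm sel Fn F0 wc upper[rule_format] \<phi>]) (assumption | rule that)+
  have hi: "integrable M h" using h g(1,3) by (rule integrable_selection_bound)
  note bl = norming_bounded_linear[OF \<phi>]
  have "(\<lambda>n. \<phi> k (\<integral>t. f (r n) t \<partial>M)) \<longlonglongrightarrow> \<phi> k (\<integral>t. h t \<partial>M)" for k
  proof -
    have meas: "(\<lambda>t. \<phi> k (u t)) \<in> borel_measurable M" if "integrable M u" for u
      using integrable_bounded_linear[OF bl that, of k] by simp
    have "(\<lambda>n. \<integral>t. \<phi> k (f (r n) t) \<partial>M) \<longlonglongrightarrow> (\<integral>t. \<phi> k (h t) \<partial>M)"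
    proof (rule weak_conv_m_integral[OF prob_space_axioms _ _ wcm g(1) _ g(1)])
      show "AE t in M. \<bar>\<phi> k (f (r n) t)\<bar> \<le> g t" for n
        using g(2)[of "r n"] by eventually_elim (rule order_trans[OF norming_abs_le[OF \<phi>]])
      show "AE t in M. \<bar>\<phi> k (h t)\<bar> \<le> g t"
        using h(2) g(3) by eventually_elim (rule order_trans[OF norming_abs_le[OF \<phi>]], blast)
    qed (intro meas f hi)+
    then show ?thesis by (simp add: integral_bounded_linear[OF bl] f hi)
  qed
  then show ?thesis using r hi h(2) by blast
qed

text \<open>Prepending an arbitrary functional to the norming sequence identifies the weak limit: all
  cluster points agree on the norming sequence.\<close>
lemma integral_limit:
  fixes f :: "nat \<Rightarrow> 't \<Rightarrow> 'x::{banach, second_countable_topology}"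
  assumes f: "\<And>n. integrable M (f n)" and sel: "\<And>n. AE t in M. f n t \<in> Fn n t"
    and Fn: "\<And>n. measurable_correspondence (space M) \<F> (Fn n)"
    and F0: "measurable_correspondence (space M) \<F> F0"
    and wc: "AE t in M. compactin weak_topology (F0 t)"
    and upper: "\<forall>t\<in>space M. \<forall>V. openin weak_topology V \<longrightarrow> F0 t \<subseteq> V \<longrightarrow>
      (\<forall>\<^sub>F n in sequentially. Fn n t \<subseteq> V)"
    and g: "integrable M g" "\<And>n. AE t in M. norm (f n t) \<le> g t" "AE t in M. \<forall>x\<in>F0 t. norm x \<le> g t"
  shows "\<exists>r a. strict_mono r \<and> a \<in> integral_correspondence M F0 \<and>
    (\<forall>\<psi> :: 'x \<Rightarrow> real. bounded_linear \<psi> \<longrightarrow> (\<lambda>n. \<psi> (\<integral>t. f (r n) t \<partial>M)) \<longlonglongrightarrow> \<psi> a)"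
proof -
  obtain \<phi> :: "nat \<Rightarrow> 'x \<Rightarrow> real" where \<phi>: "norming \<phi>" using norming_exists by (rule exE)
  obtain r h where r: "strict_mono r" and h: "integrable M h" "AE t in M. h t \<in> F0 t"
    and lim: "\<forall>k. (\<lambda>n. \<phi> k (\<integral>t. f (r n) t \<partial>M)) \<longlonglongrightarrow> \<phi> k (\<integral>t. h t \<partial>M)"
    using integral_limit_norming[of f Fn F0 g \<phi>, OF f sel Fn F0 wc upper g \<phi>] by (elim exE conjE) (rule that)
  have "(\<lambda>n. \<psi> (\<integral>t. f (r n) t \<partial>M)) \<longlonglongrightarrow> \<psi> (\<integral>t. h t \<partial>M)"
    if bl: "bounded_linear \<psi>" for \<psi> :: "'x \<Rightarrow> real"
  proof -
    obtain B where B: "0 < B" "\<And>x. norm (\<psi> x) \<le> norm x * B"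
      using bounded_linear.pos_bounded[OF bl] by (elim exE conjE) (rule that, auto)
    \<comment> \<open>Rescaling puts the functional below the norm, as membership in a norming
      sequence requires.\<close>
    define \<theta> where "\<theta> x = inverse B * \<psi> x" for x
    have \<theta>: "bounded_linear \<theta>" unfolding \<theta>_def by (rule bounded_linear_const_mult[OF bl])
    have \<theta>_le: "\<theta> x \<le> norm x" for x
      using B(2)[of x] B(1) by (simp add: \<theta>_def field_simps)
    have "(\<lambda>n. \<theta> (\<integral>t. f (r n) t \<partial>M)) \<longlonglongrightarrow> \<theta> (\<integral>t. h t \<partial>M)"
    proof (rule ccontr)
      assume "\<not> ?thesis"
      then obtain e where e: "0 < e"
        "\<not> (\<forall>\<^sub>F n in sequentially. dist (\<theta> (\<integral>t. f (r n) t \<partial>M)) (\<theta> (\<integral>t. h t \<partial>M)) < e)"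
        unfolding tendsto_iff by blast
      \<comment> \<open>Along a subsequence that stays away from the supposed limit, a further one
        converges for \<open>\<theta>\<close> as well, to its value at the integral of some
        \<open>h'\<close>. The coordinates \<open>\<phi>\<close> identify this integral with that of
        \<open>h\<close>.\<close>
      obtain s :: "nat \<Rightarrow> nat" where s: "strict_mono s"
        "\<And>n. \<not> dist (\<theta> (\<integral>t. f (r (s n)) t \<partial>M)) (\<theta> (\<integral>t. h t \<partial>M)) < e"
        using not_eventually_sequentiallyD[OF e(2)] by (elim exE conjE) (rule that, assumption, erule spec)
      have rs: "strict_mono (\<lambda>n. r (s n))" using r s(1) by (simp add: strict_mono_def)
      have upper': "\<forall>t\<in>space M. \<forall>V. openin weak_topology V \<longrightarrow> F0 t \<subseteq> V \<longrightarrow>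
          (\<forall>\<^sub>F n in sequentially. Fn (r (s n)) t \<subseteq> V)"
      proof (intro ballI allI impI)
        fix t V assume "t \<in> space M" "openin weak_topology V" "F0 t \<subseteq> V"
        from eventually_subseq[OF rs upper[rule_format, OF this]]
        show "\<forall>\<^sub>F n in sequentially. Fn (r (s n)) t \<subseteq> V" .
      qed
      obtain r' h' where r': "strict_mono r'" and h': "integrable M h'" "AE t in M. h' t \<in> F0 t"
        and lim': "\<forall>k. (\<lambda>n. case_nat \<theta> \<phi> k (\<integral>t. f (r (s (r' n))) t \<partial>M)) \<longlonglongrightarrow> case_nat \<theta> \<phi> k (\<integral>t. h' t \<partial>M)"
        using integral_limit_norming[of "\<lambda>n. f (r (s n))" "\<lambda>n. Fn (r (s n))" F0 g "case_nat \<theta> \<phi>",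
            OF f sel Fn F0 wc upper' g(1,2,3) norming_Cons[OF \<phi> \<theta> \<theta>_le]] by (elim exE conjE) (rule that)
      have "(\<integral>t. h' t \<partial>M) = (\<integral>t. h t \<partial>M)"
      proof (rule norming_eqI[OF \<phi>])
        fix k
        have "strict_mono (\<lambda>n. s (r' n))" using r' s(1) by (simp add: strict_mono_def)
        from LIMSEQ_subseq_LIMSEQ[OF lim[rule_format, of k] this]
        have "(\<lambda>n. \<phi> k (\<integral>t. f (r (s (r' n))) t \<partial>M)) \<longlonglongrightarrow> \<phi> k (\<integral>t. h t \<partial>M)" by (simp add: o_def)
        moreover have "(\<lambda>n. \<phi> k (\<integral>t. f (r (s (r' n))) t \<partial>M)) \<longlonglongrightarrow> \<phi> k (\<integral>t. h' t \<partial>M)"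
          using lim'[rule_format, of "Suc k"] by simp
        ultimately show "\<phi> k (\<integral>t. h' t \<partial>M) = \<phi> k (\<integral>t. h t \<partial>M)" by (rule LIMSEQ_unique[rotated])
      qed
      then have "(\<lambda>n. \<theta> (\<integral>t. f (r (s (r' n))) t \<partial>M)) \<longlonglongrightarrow> \<theta> (\<integral>t. h t \<partial>M)"
        using lim'[rule_format, of 0] by simp
      then have "\<forall>\<^sub>F n in sequentially. dist (\<theta> (\<integral>t. f (r (s (r' n))) t \<partial>M)) (\<theta> (\<integral>t. h t \<partial>M)) < e"
        using e(1) by (rule tendstoD)
      then show False using s(2) by simp
    qed
    then have "(\<lambda>n. B * \<theta> (\<integral>t. f (r n) t \<partial>M)) \<longlonglongrightarrow> B * \<theta> (\<integral>t. h t \<partial>M)" by (rule tendsto_mult_left)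
    then show ?thesis using B(1) by (simp add: \<theta>_def)
  qed
  then show ?thesis using r integral_correspondenceI[OF h] by blast
qed

section \<open>Compactness, convexity, closed convex hulls and upper hemicontinuity of the
  integral\<close>

theorem integral_correspondence_weakly_compact:
  fixes F :: "'t \<Rightarrow> 'x::{banach, second_countable_topology} set"
  assumes F: "measurable_correspondence (space M) \<F> F" and ib: "integrably_bounded M F"
    and wc: "weakly_compact_valued M F"
  shows "compactin weak_topology (integral_correspondence M F)"
proof (rule weakly_sequentially_compact_imp_compact)
  fix x :: "nat \<Rightarrow> 'x" assume x: "\<And>n. x n \<in> integral_correspondence M F"
  have "\<exists>f. integrable M f \<and> (AE t in M. f t \<in> F t) \<and> x n = integral\<^sup>L M f" for n
    using x[of n] by (auto simp: integral_correspondence_def selection_def)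
  then have "\<exists>f. \<forall>n. integrable M (f n) \<and> (AE t in M. f n t \<in> F t) \<and> x n = integral\<^sup>L M (f n)"
    by (rule choice[OF allI])
  then obtain f where f: "\<And>n. integrable M (f n)" "\<And>n. AE t in M. f n t \<in> F t" "\<And>n. x n = integral\<^sup>L M (f n)"
    by blast
  obtain g where g: "integrable M g" "AE t in M. \<forall>x\<in>F t. norm x \<le> g t"
    using ib unfolding integrably_bounded_def by blast
  have fg: "AE t in M. norm (f n t) \<le> g t" for n using f(2)[of n] g(2) by eventually_elim blast
  have up: "\<forall>t\<in>space M. \<forall>V. openin weak_topology V \<longrightarrow> F t \<subseteq> V \<longrightarrow>
      (\<forall>\<^sub>F n :: nat in sequentially. F t \<subseteq> V)" by simp
  show "\<exists>r a. strict_mono r \<and> a \<in> integral_correspondence M F \<and>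
      (\<forall>\<phi> :: 'x \<Rightarrow> real. bounded_linear \<phi> \<longrightarrow> (\<lambda>n. \<phi> (x (r n))) \<longlonglongrightarrow> \<phi> a)"
    unfolding f(3)
    by (rule integral_limit[of f "\<lambda>_. F" F g, OF f(1,2) F F wc[unfolded weakly_compact_valued_def] up g(1) fg g(2)])
qed

text \<open>An independent coin showing \<open>True\<close> with probability \<open>u\<close>
  chooses \<open>g\<close> instead of \<open>f\<close>, so the integral over the product is
  \<open>(1 - u) *\<^sub>R x + u *\<^sub>R y\<close>. The selection \<open>h\<close> on
  \<open>M\<close> has the same coordinate distributions, hence the same integral.\<close>

theorem integral_correspondence_convex:
  fixes F :: "'t \<Rightarrow> 'x::{banach, second_countable_topology} set"
  assumes F: "measurable_correspondence (space M) \<F> F" and wc: "weakly_compact_valued M F"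
  shows "convex (integral_correspondence M F)"
  unfolding convex_alt
proof (intro ballI allI impI, elim conjE)
  fix x y and u :: real
  assume xy: "x \<in> integral_correspondence M F" "y \<in> integral_correspondence M F" and u: "0 \<le> u" "u \<le> 1"
  obtain f where f: "integrable M f" "AE t in M. f t \<in> F t" "x = integral\<^sup>L M f"
    using xy(1) by (rule integral_correspondenceE)
  obtain g where g: "integrable M g" "AE t in M. g t \<in> F t" "y = integral\<^sup>L M g"
    using xy(2) by (rule integral_correspondenceE)
  have [measurable]: "f \<in> borel_measurable M" "g \<in> borel_measurable M" using f(1) g(1) by auto
  define B where "B = measure_pmf (bernoulli_pmf u)"
  define N where "N = M \<Otimes>\<^sub>M B"
  interpret B: prob_space B unfolding B_def by (rule prob_space_measure_pmf)
  interpret MB: pair_prob_space M B ..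
  have [measurable_cong]: "sets B = sets (count_space UNIV)" by (simp add: B_def)
  have fst[measurable]: "fst \<in> measurable N M" by (simp add: N_def)
  have distr_fst: "distr N M fst = M" unfolding N_def by (rule B.distr_pair_fst)
  have N: "prob_space N" unfolding N_def by (rule MB.prob_space_axioms)
  interpret E: measure_preserving_extension M \<F> N fst
    by (intro measure_preserving_extension.intro nowhere_equivalent_space_axioms N
        measure_preserving_extension_axioms.intro fst distr_fst)
  define k where "k w = (if snd w then g (fst w) else f (fst w))" for w :: "'t \<times> bool"
  have k[measurable]: "k \<in> borel_measurable N" unfolding k_def N_def by measurable
  have ksel: "AE w in N. k w \<in> F (fst w)"
  proof -
    have "AE t in distr N M fst. f t \<in> F t \<and> g t \<in> F t" unfolding distr_fst using f(2) g(2) by eventually_elim simp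
    then have "AE w in N. f (fst w) \<in> F (fst w) \<and> g (fst w) \<in> F (fst w)" by (rule AE_distrD[OF fst])
    then show ?thesis by eventually_elim (simp add: k_def)
  qed
  have bern: "(\<integral>b. v b \<partial>B) = u * v True + (1 - u) * v False" for v :: "bool \<Rightarrow> real"
    unfolding B_def using integral_bernoulli_pmf[OF u, of v] by (simp add: mult.commute)
  have Bint: "integrable B v" for v :: "bool \<Rightarrow> 'x"
    unfolding B_def by (rule integrable_measure_pmf_finite) simp
  have kint: "integrable N k"
    unfolding N_def
  proof (rule MB.Fubini_integrable)
    show "k \<in> borel_measurable (M \<Otimes>\<^sub>M B)" using k by (simp add: N_def)
    show "integrable M (\<lambda>t. \<integral>b. norm (k (t, b)) \<partial>B)"
      unfolding bern using f(1) g(1) by (simp add: k_def)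
    show "AE t in M. integrable B (\<lambda>b. k (t, b))" using Bint by simp
  qed
  obtain \<phi> :: "nat \<Rightarrow> 'x \<Rightarrow> real" where \<phi>: "norming \<phi>" using norming_exists by (rule exE)
  note bl = norming_bounded_linear[OF \<phi>]
  have up: "\<And>t V. t \<in> space M \<Longrightarrow> openin weak_topology V \<Longrightarrow> F t \<subseteq> V \<Longrightarrow>
      \<forall>\<^sub>F n :: nat in sequentially. F t \<subseteq> V" by simp
  obtain h where h: "h \<in> borel_measurable M" "AE t in M. h t \<in> F t"
    and wcm: "\<And>j. weak_conv_m (\<lambda>n :: nat. distr N borel (\<lambda>w. \<phi> j (k w))) (distr M borel (\<lambda>t. \<phi> j (h t)))"
    and tail: "\<And>i :: nat. \<exists>c. (\<lambda>n :: nat. E.N.prob {w \<in> space N. norm (k w) \<le> real i}) \<longlonglongrightarrow> c \<and>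
        c \<le> prob {t \<in> space M. norm (h t) \<le> real i}"
    by (rule E.limit_selection[of "\<lambda>_. k" "\<lambda>_. F" F \<phi>, OF k ksel F F wc[unfolded weakly_compact_valued_def] up \<phi>])
      (assumption | rule that)+
  \<comment> \<open>No integrable bound on \<open>F\<close> is at hand; integrability of
    \<open>h\<close> comes from its tails, which are dominated by those of the integrable
    \<open>k\<close>.\<close>
  have "integrable M (\<lambda>t. norm (h t))"
  proof (rule integrable_of_tail_bound[OF N prob_space_axioms, where X = "\<lambda>w. norm (k w)"])
    show "E.N.prob {w \<in> space N. norm (k w) \<le> real i} \<le> prob {t \<in> space M. norm (h t) \<le> real i}" for i
      using tail[of i] by (auto simp: LIMSEQ_const_iff)
  qed (use kint h(1) in auto)
  then have hi: "integrable M h" using h(1) by (simp add: integrable_norm_iff)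
  have meas: "(\<lambda>t. \<phi> j (v t)) \<in> borel_measurable M'" if "integrable M' v" for j v and M' :: "'s measure"
    using integrable_bounded_linear[OF bl that, of j] by simp
  have "integral\<^sup>L M h = (1 - u) *\<^sub>R x + u *\<^sub>R y"
  proof (rule norming_eqI[OF \<phi>])
    fix j
    interpret bounded_linear "\<phi> j" by (rule bl)
    have "(\<lambda>n :: nat. \<integral>w. \<phi> j (k w) \<partial>N) \<longlonglongrightarrow> (\<integral>t. \<phi> j (h t) \<partial>M)"
    proof (rule weak_conv_m_integral[OF N _ _ wcm, where g = "\<lambda>w. norm (k w)" and h = "\<lambda>t. norm (h t)"])
      show "(\<lambda>w. \<phi> j (k w)) \<in> borel_measurable N" by (rule meas[OF kint])
      show "(\<lambda>t. \<phi> j (h t)) \<in> borel_measurable M" by (rule meas[OF hi])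
    qed (use kint hi norming_abs_le[OF \<phi>] in auto)
    then have "(\<integral>t. \<phi> j (h t) \<partial>M) = (\<integral>w. \<phi> j (k w) \<partial>N)" by (simp add: LIMSEQ_const_iff)
    also have "\<dots> = (\<integral>t. (\<integral>b. \<phi> j (k (t, b)) \<partial>B) \<partial>M)"
      unfolding N_def
      by (rule MB.integral_fst'[symmetric]) (use integrable_bounded_linear[OF bl kint] in \<open>simp add: N_def\<close>)
    also have "\<dots> = (\<integral>t. u * \<phi> j (g t) + (1 - u) * \<phi> j (f t) \<partial>M)" by (simp add: bern k_def)
    also have "\<dots> = u * \<phi> j y + (1 - u) * \<phi> j x"
      using integrable_bounded_linear[OF bl f(1), of j] integrable_bounded_linear[OF bl g(1), of j]
      by (simp add: f(3) g(3) integral_bounded_linear[OF bl] f(1) g(1))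
    finally show "\<phi> j (integral\<^sup>L M h) = \<phi> j ((1 - u) *\<^sub>R x + u *\<^sub>R y)"
      by (simp add: integral_bounded_linear[OF bl hi] add scaleR)
  qed
  then show "(1 - u) *\<^sub>R x + u *\<^sub>R y \<in> integral_correspondence M F"
    using integral_correspondenceI[OF hi h(2)] by simp
qed

text \<open>Upper hemicontinuity includes nonempty values, so an integrable selection has to be
  produced. The one obtained lies in the closure of \<open>F t\<close>, which is \<open>F t\<close>
  almost everywhere.\<close>

lemma integral_correspondence_nonempty:
  fixes F :: "'t \<Rightarrow> 'x::{banach, second_countable_topology} set"
  assumes co: "correspondence (space M) UNIV F" and F: "measurable_correspondence (space M) \<F> F"
    and cl: "AE t in M. closed (F t)"
    and g: "integrable M g" "AE t in M. \<forall>x\<in>F t. norm x \<le> g t"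
  shows "integral_correspondence M F \<noteq> {}"
proof -
  obtain f where f: "f \<in> borel_measurable M" "\<And>t. t \<in> space M \<Longrightarrow> f t \<in> closure (F t)"
  proof (rule measurable_selection[of M F])
    show "{t \<in> space M. F t \<inter> E \<noteq> {}} \<in> sets M" if "closed E" for E
      using F that unfolding measurable_correspondence_def by (intro F_measurable) blast
    show "F t \<noteq> {}" if "t \<in> space M" for t using co that unfolding correspondence_def by blast
  qed (rule that)
  have "AE t in M. f t \<in> F t"
    using cl AE_space by eventually_elim (metis f(2) closure_closed)
  then show ?thesis
    using integral_correspondenceI integrable_selection_bound[OF f(1) _ g] by blast
qed

text \<open>Near maximality is measured against the given \<open>p\<close> and not against the
  supremum of the functional on \<open>F t\<close>. It suffices to fall short of
  \<open>\<phi> (p t)\<close> by at most half of the gap \<open>d\<close>: the integral of such a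
  selection lies in \<open>S\<close> and violates the separation.\<close>

theorem integral_correspondence_closed_convex_hull:
  fixes F :: "'t \<Rightarrow> 'x::{banach, second_countable_topology} set"
  assumes co: "correspondence (space M) UNIV F" and F: "measurable_correspondence (space M) \<F> F"
    and ib: "integrably_bounded M F" and wc: "weakly_compact_valued M F"
  shows "integral_correspondence M F = integral_correspondence M (\<lambda>t. closure (convex hull F t))"
proof
  show "integral_correspondence M F \<subseteq> integral_correspondence M (\<lambda>t. closure (convex hull F t))"
  proof
    fix x assume "x \<in> integral_correspondence M F"
    then obtain f where f: "integrable M f" "AE t in M. f t \<in> F t" "x = integral\<^sup>L M f"
      by (rule integral_correspondenceE)
    have "AE t in M. f t \<in> closure (convex hull F t)"
      using f(2) by eventually_elim (meson closure_subset hull_subset subsetD)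
    then show "x \<in> integral_correspondence M (\<lambda>t. closure (convex hull F t))"
      unfolding f(3) by (rule integral_correspondenceI[OF f(1)])
  qed
next
  obtain g where g: "integrable M g" "AE t in M. \<forall>x\<in>F t. norm x \<le> g t"
    using ib unfolding integrably_bounded_def by blast
  have cl: "AE t in M. closed (F t)"
    using wc unfolding weakly_compact_valued_def by eventually_elim (rule weakly_compact_imp_closed)
  show "integral_correspondence M (\<lambda>t. closure (convex hull F t)) \<subseteq> integral_correspondence M F"
  proof
    fix x assume "x \<in> integral_correspondence M (\<lambda>t. closure (convex hull F t))"
    then obtain p where p: "integrable M p" "AE t in M. p t \<in> closure (convex hull F t)" "x = integral\<^sup>L M p"
      by (rule integral_correspondenceE)
    have [measurable]: "p \<in> borel_measurable M" using p(1) by simp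
    define S where "S = integral_correspondence M F"
    have S: "closed S" "convex S"
      unfolding S_def
      by (intro weakly_compact_imp_closed integral_correspondence_weakly_compact
          integral_correspondence_convex F ib wc)+
    show "x \<in> integral_correspondence M F"
    proof (rule ccontr)
      assume "x \<notin> integral_correspondence M F"
      then obtain d where d: "0 < d" "ball x d \<subseteq> - S"
        using S(1) open_contains_ball[of "- S"] by (auto simp: S_def)
      have far: "d \<le> norm (x - c)" if "c \<in> S" for c
      proof (rule ccontr)
        assume "\<not> d \<le> norm (x - c)"
        then have "c \<in> ball x d" by (simp add: dist_norm)
        then show False using d(2) that by blast
      qed
      obtain \<phi> :: "'x \<Rightarrow> real" where bl: "bounded_linear \<phi>" and sep: "\<And>c. c \<in> S \<Longrightarrow> \<phi> c + d \<le> \<phi> x"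
        by (rule hahn_banach_separation[OF S(2) far]) (assumption | rule that)+
      have \<phi>_le_closed: "closed {y. \<phi> y \<le> a}" and \<phi>_ge_closed: "closed {y. a \<le> \<phi> y}" for a
        by (intro closed_Collect_le linear_continuous_on[OF bl] continuous_on_const)+
      have \<phi>_convex: "convex {y. \<phi> y \<le> a}" for a
      proof -
        interpret bounded_linear \<phi> by (rule bl)
        have "convex (\<phi> -` {..a})" by (intro convex_linear_vimage linear) simp
        then show ?thesis by (simp add: vimage_def)
      qed
      define e where "e = d / 2"
      have e: "0 < e" using d(1) by (simp add: e_def)
      \<comment> \<open>The level is rounded to a multiple of \<open>e\<close>, so that
        \<open>H\<close> takes countably many values and intersecting with it preserves
        measurability. Subtracting 1 from the ceiling puts the level strictly below
        \<open>\<phi> (p t)\<close>, which makes \<open>F t \<inter> H t\<close> nonempty almost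
        everywhere.\<close>
      define z where "z t = \<lceil>\<phi> (p t) / e\<rceil> - 1" for t
      have z: "e * of_int (z t) < \<phi> (p t)" "\<phi> (p t) - e \<le> e * of_int (z t)" for t
      proof -
        have "of_int (z t) < \<phi> (p t) / e" "\<phi> (p t) / e - 1 \<le> of_int (z t)"
          unfolding z_def by linarith+
        then show "e * of_int (z t) < \<phi> (p t)" "\<phi> (p t) - e \<le> e * of_int (z t)"
          using e by (simp_all add: field_simps)
      qed
      have [measurable]: "(\<lambda>t. \<phi> (p t)) \<in> borel_measurable M"
        using integrable_bounded_linear[OF bl p(1)] by simp
      have z_meas: "{t \<in> space M. z t = m} \<in> sets M" for m unfolding z_def by measurable
      define H where "H t = {y. e * of_int (z t) \<le> \<phi> y}" for t
      have H_closed: "closed (H t)" for t unfolding H_def by (rule \<phi>_ge_closed)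
      \<comment> \<open>Falling back to \<open>F t\<close> keeps the values nonempty at every
        \<open>t\<close>, as the selection lemma demands; the fallback occurs only on a null
        set.\<close>
      define G where "G t = (if F t \<inter> H t = {} then F t else F t \<inter> H t)" for t
      have FE: "{t \<in> space M. F t \<inter> E \<noteq> {}} \<in> sets M" if "closed E" for E
        using F that unfolding measurable_correspondence_def by (intro F_measurable) blast
      have HE: "{t \<in> space M. F t \<inter> H t \<inter> E \<noteq> {}} \<in> sets M" if E: "closed E" for E
      proof -
        have "{t \<in> space M. F t \<inter> H t \<inter> E \<noteq> {}} =
          (\<Union>m. {t \<in> space M. z t = m} \<inter> {t \<in> space M. F t \<inter> ({y. e * of_int m \<le> \<phi> y} \<inter> E) \<noteq> {}})"
          by (auto simp: H_def)
        also have "\<dots> \<in> sets M"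
          using sets.Int[OF z_meas FE[OF closed_Int[OF \<phi>_ge_closed E]]]
          by (intro sets.countable_UN') auto
        finally show ?thesis .
      qed
      \<comment> \<open>\<open>H\<close> depends on \<open>p\<close>, which is measurable for
        \<open>M\<close> but not necessarily for \<open>\<F>\<close>; accordingly the selection is
        taken over \<open>M\<close>.\<close>
      obtain f where f: "f \<in> borel_measurable M" "\<And>t. t \<in> space M \<Longrightarrow> f t \<in> closure (G t)"
      proof (rule measurable_selection[of M G])
        show "G t \<noteq> {}" if "t \<in> space M" for t
          using co that unfolding correspondence_def by (auto simp: G_def)
        show "{t \<in> space M. G t \<inter> E \<noteq> {}} \<in> sets M" if E: "closed E" for E
        proof -
          have "{t \<in> space M. G t \<inter> E \<noteq> {}} = {t \<in> space M. F t \<inter> H t \<inter> E \<noteq> {}} \<union>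
            ({t \<in> space M. F t \<inter> E \<noteq> {}} - {t \<in> space M. F t \<inter> H t \<inter> UNIV \<noteq> {}})"
            by (auto simp: G_def)
          also have "\<dots> \<in> sets M" by (intro sets.Un sets.Diff HE FE E closed_UNIV)
          finally show ?thesis .
        qed
      qed (rule that)
      have fFH: "AE t in M. f t \<in> F t \<inter> H t"
        using cl p(2) AE_space
      proof eventually_elim
        case (elim t)
        have "F t \<inter> H t \<noteq> {}"
        proof
          assume "F t \<inter> H t = {}"
          \<comment> \<open>A closed half-space containing \<open>F t\<close> contains its closed
            convex hull, but \<open>p t\<close> lies strictly outside this one.\<close>
          then have "F t \<subseteq> {y. \<phi> y \<le> e * of_int (z t)}" by (force simp: H_def)
          then have "convex hull F t \<subseteq> {y. \<phi> y \<le> e * of_int (z t)}" using \<phi>_convex by (rule hull_minimal)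
          then have "closure (convex hull F t) \<subseteq> {y. \<phi> y \<le> e * of_int (z t)}"
            using \<phi>_le_closed by (rule closure_minimal)
          then show False using elim(2) z(1)[of t] by auto
        qed
        then have "G t = F t \<inter> H t" by (simp add: G_def)
        then show ?case using f(2)[OF elim(3)] closed_Int[OF elim(1) H_closed] by (simp add: closure_closed)
      qed
      then have fF: "AE t in M. f t \<in> F t" by eventually_elim simp
      have fi: "integrable M f" by (rule integrable_selection_bound[OF f(1) fF g])
      have "\<phi> x - e = (\<integral>t. \<phi> (p t) - e \<partial>M)"
        using integrable_bounded_linear[OF bl p(1)]
        by (simp add: p(3) integral_bounded_linear[OF bl p(1)] prob_space)
      also have "\<dots> \<le> (\<integral>t. \<phi> (f t) \<partial>M)"
      proof (rule integral_mono_AE)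
        show "AE t in M. \<phi> (p t) - e \<le> \<phi> (f t)"
          using fFH by eventually_elim (use z(2) in \<open>force simp: H_def intro: order_trans\<close>)
      qed (use integrable_bounded_linear[OF bl p(1)] integrable_bounded_linear[OF bl fi] in auto)
      also have "\<dots> = \<phi> (integral\<^sup>L M f)" by (rule integral_bounded_linear[OF bl fi])
      finally have "\<phi> x - e \<le> \<phi> (integral\<^sup>L M f)" .
      moreover have "\<phi> (integral\<^sup>L M f) + d \<le> \<phi> x"
        by (rule sep) (simp add: S_def integral_correspondenceI[OF fi fF])
      ultimately show False using d(1) by (simp add: e_def)
    qed
  qed
qed

text \<open>Violations near \<open>y0\<close> are collected along a sequence \<open>y n\<close>
  tending to \<open>y0\<close>. Upper hemicontinuity at each \<open>t\<close> supplies what the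
  limit lemma asks of the varying correspondences; a weak limit of the integrals then lies in
  \<open>H y0\<close>, hence in \<open>V\<close>, contrary to their choice outside
  \<open>V\<close>.\<close>

theorem integral_correspondence_upper_hemicontinuous:
  fixes G :: "'t \<Rightarrow> 'x::{banach, second_countable_topology} set" and F :: "'t \<times> 'y::metric_space \<Rightarrow> 'x set"
  assumes ib: "integrably_bounded M G" and wc: "weakly_compact_valued M G"
    and co: "correspondence (space M \<times> UNIV) UNIV F"
    and cl: "\<And>y. weakly_closed_valued M (\<lambda>t. F (t, y))"
    and FG: "\<And>y. AE t in M. F (t, y) \<subseteq> G t"
    and F: "\<And>y. measurable_correspondence (space M) \<F> (\<lambda>t. F (t, y))"
    and uhc: "\<And>t. t \<in> space M \<Longrightarrow> weakly_upper_hemicontinuous (\<lambda>y. F (t, y))"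
  shows "weakly_upper_hemicontinuous (\<lambda>y. integral_correspondence M (\<lambda>t. F (t, y)))"
proof -
  define H where "H y = integral_correspondence M (\<lambda>t. F (t, y))" for y
  obtain g where g: "integrable M g" "AE t in M. \<forall>x\<in>G t. norm x \<le> g t"
    using ib unfolding integrably_bounded_def by blast
  have gF: "AE t in M. \<forall>x\<in>F (t, y). norm x \<le> g t" for y
    using g(2) FG[of y] by eventually_elim blast
  \<comment> \<open>Weakly closed subsets of the weakly compact \<open>G t\<close> are weakly
    compact; the null set may depend on \<open>y\<close>.\<close>
  have wcF: "AE t in M. compactin weak_topology (F (t, y))" for y
    using wc[unfolded weakly_compact_valued_def] FG[of y] cl[of y, unfolded weakly_closed_valued_def]
    by eventually_elim (rule closed_compactin)
  have ne: "H y \<noteq> {}" for y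
    unfolding H_def
  proof (rule integral_correspondence_nonempty[OF _ F _ g(1) gF])
    show "correspondence (space M) UNIV (\<lambda>t. F (t, y))" using co by (auto simp: correspondence_def)
    show "AE t in M. closed (F (t, y))" using wcF by eventually_elim (rule weakly_compact_imp_closed)
  qed
  have up: "\<exists>U. openin euclidean U \<and> y0 \<in> U \<and> (\<forall>y\<in>U. H y \<subseteq> V)"
    if V: "openin weak_topology V" "H y0 \<subseteq> V" for y0 V
  proof (rule ccontr)
    assume no: "\<nexists>U. openin euclidean U \<and> y0 \<in> U \<and> (\<forall>y\<in>U. H y \<subseteq> V)"
    have "\<exists>y f. dist y0 y < 1 / Suc n \<and> integrable M f \<and> (AE t in M. f t \<in> F (t, y)) \<and> integral\<^sup>L M f \<notin> V" for n
    proof -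
      have "openin euclidean (ball y0 (1 / Suc n))" "y0 \<in> ball y0 (1 / Suc n)" by simp_all
      then have "\<not> (\<forall>y\<in>ball y0 (1 / Suc n). H y \<subseteq> V)"
        using no[unfolded not_ex, THEN spec, of "ball y0 (1 / Suc n)"] by iprover
      then obtain y where y: "y \<in> ball y0 (1 / Suc n)" "\<not> H y \<subseteq> V" by blast
      then obtain x where "x \<in> H y" "x \<notin> V" by blast
      then show ?thesis using y(1) unfolding H_def by (elim integral_correspondenceE) auto
    qed
    then have "\<forall>n. \<exists>yf. dist y0 (fst yf) < 1 / Suc n \<and> integrable M (snd yf) \<and>
        (AE t in M. snd yf t \<in> F (t, fst yf)) \<and> integral\<^sup>L M (snd yf) \<notin> V" by simp
    from choice[OF this] obtain yf where yf: "\<forall>n. dist y0 (fst (yf n)) < 1 / Suc n \<and> integrable M (snd (yf n)) \<and>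
        (AE t in M. snd (yf n) t \<in> F (t, fst (yf n))) \<and> integral\<^sup>L M (snd (yf n)) \<notin> V" by (rule exE)
    define y where "y n = fst (yf n)" for n
    define f where "f n = snd (yf n)" for n
    have y: "dist (y n) y0 < 1 / Suc n" and f: "integrable M (f n)" "AE t in M. f n t \<in> F (t, y n)"
      "integral\<^sup>L M (f n) \<notin> V" for n
      using yf by (auto simp: y_def f_def dist_commute)
    have y_lim: "y \<longlonglongrightarrow> y0"
    proof (rule metric_LIMSEQ_I)
      fix r :: real assume "0 < r"
      then obtain m where m: "1 / real (Suc m) < r" by (rule nat_approx_posE)
      have "dist (y n) y0 < r" if "n \<ge> m" for n
      proof -
        have "1 / real (Suc n) \<le> 1 / real (Suc m)" using that by (simp add: frac_le)
        then show ?thesis using y[of n] m by linarith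
      qed
      then show "\<exists>m. \<forall>n\<ge>m. dist (y n) y0 < r" by blast
    qed
    have upper: "\<forall>t\<in>space M. \<forall>V. openin weak_topology V \<longrightarrow> F (t, y0) \<subseteq> V \<longrightarrow>
        (\<forall>\<^sub>F n in sequentially. F (t, y n) \<subseteq> V)"
    proof (intro ballI allI impI)
      fix t V assume t: "t \<in> space M" and V: "openin weak_topology V" "F (t, y0) \<subseteq> V"
      have "\<exists>U. openin euclidean U \<and> y0 \<in> U \<and> (\<forall>y\<in>U. F (t, y) \<subseteq> V)"
        using uhc[OF t] V unfolding upper_hemicontinuous_def by simp
      then obtain U where U: "open U" "y0 \<in> U" "\<forall>y\<in>U. F (t, y) \<subseteq> V" by auto
      have "\<forall>\<^sub>F n in sequentially. y n \<in> U" using y_lim U(1,2) by (rule topological_tendstoD)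
      then show "\<forall>\<^sub>F n in sequentially. F (t, y n) \<subseteq> V" by (rule eventually_mono) (use U(3) in blast)
    qed
    have fg: "AE t in M. norm (f n t) \<le> g t" for n using f(2)[of n] gF[of "y n"] by eventually_elim blast
    obtain r a where r: "strict_mono r" and a: "a \<in> integral_correspondence M (\<lambda>t. F (t, y0))" and
      lim: "\<forall>\<psi> :: 'x \<Rightarrow> real. bounded_linear \<psi> \<longrightarrow> (\<lambda>n. \<psi> (\<integral>t. f (r n) t \<partial>M)) \<longlonglongrightarrow> \<psi> a"
      using integral_limit[of f "\<lambda>n t. F (t, y n)" "\<lambda>t. F (t, y0)" g, OF f(1,2) F F wcF upper g(1) fg gF]
      by (elim exE conjE) (rule that)
    have "a \<in> V" using a V(2) by (auto simp: H_def)
    with V(1) have "\<forall>\<^sub>F n in sequentially. integral\<^sup>L M (f (r n)) \<in> V"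
      using lim[rule_format] by (rule eventually_in_weak_open[where x = "\<lambda>n. integral\<^sup>L M (f (r n))"])
    then show False using f(3) by simp
  qed
  show ?thesis
    unfolding upper_hemicontinuous_def correspondence_def H_def[symmetric]
    using ne up by simp
qed

end

theorem proposition1:
  fixes M :: "'t measure" and \<F> :: "'t set set"
  assumes "prob_space M" and "complete_measure M" and "atomless M"
    and "sigma_algebra (space M) \<F>" and "\<F> \<subseteq> sets M"
    and "countably_generated (space M) \<F>"
    and "nowhere_equivalent M \<F>"
  shows
    "(\<forall>F :: 't \<Rightarrow> 'x::{banach, second_countable_topology} set.
        correspondence (space M) UNIV F \<and>
        measurable_correspondence (space M) \<F> F \<and>
        weakly_compact_valued M F \<longrightarrow>
        convex (integral_correspondence M F)) \<and>
     (\<forall>F :: 't \<Rightarrow> 'x set.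
        correspondence (space M) UNIV F \<and>
        measurable_correspondence (space M) \<F> F \<and>
        integrably_bounded M F \<and>
        weakly_compact_valued M F \<longrightarrow>
        compactin weak_topology (integral_correspondence M F)) \<and>
     (\<forall>F :: 't \<Rightarrow> 'x set.
        correspondence (space M) UNIV F \<and>
        measurable_correspondence (space M) \<F> F \<and>
        integrably_bounded M F \<and>
        weakly_compact_valued M F \<longrightarrow>
        integral_correspondence M F =
        integral_correspondence M (\<lambda>t. closure (convex hull (F t)))) \<and>
     (\<forall>(G :: 't \<Rightarrow> 'x set) (F :: 't \<times> 'y::metric_space \<Rightarrow> 'x set).
        correspondence (space M) UNIV G \<and>
        measurable_correspondence (space M) \<F> G \<and>
        integrably_bounded M G \<and>
        weakly_compact_valued M G \<and>
        correspondence (space M \<times> UNIV) UNIV F \<and>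
        (\<forall>y. weakly_closed_valued M (\<lambda>t. F (t, y))) \<and>
        (\<forall>y. AE t in M. F (t, y) \<subseteq> G t) \<and>
        (\<forall>y. measurable_correspondence (space M) \<F> (\<lambda>t. F (t, y))) \<and>
        (\<forall>t\<in>space M. weakly_upper_hemicontinuous (\<lambda>y. F (t, y))) \<longrightarrow>
        weakly_upper_hemicontinuous (\<lambda>y. integral_correspondence M (\<lambda>t. F (t, y))))"
proof -
  interpret nowhere_equivalent_space M \<F>
    by (intro nowhere_equivalent_space.intro nowhere_equivalent_space_axioms.intro assms)
  show ?thesis
    by (intro conjI allI impI; elim conjE)
      (rule integral_correspondence_convex integral_correspondence_weakly_compact
        integral_correspondence_closed_convex_hull integral_correspondence_upper_hemicontinuous;
       (assumption | erule spec | erule bspec))+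
qed

end
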